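(* Let $\mu$ be a partition (possibly empty) and let $r$ and $m$ be positive integers. Then, in the ring of symmetric functions, $$s_{\mu}\,(p_r\circ h_m)=\sum_{\substack{\lambda\in\mathrm{Par}(|\mu|+rm)\\ \mu\subseteq\lambda}}\operatorname{sgn}_r(\lambda/\mu)\,s_{\lambda}.$$
   Context: Partitions. A partition $\lambda=(\lambda_1,\dots,\lambda_l)$ is a non-increasing sequence of positive integers, with size $|\lambda|=\sum_i\lambda_i$ and length $\ell(\lambda)=l$; set $\lambda_i=0$ for $i>\ell(\lambda)$. $\mathrm{Par}(n)$ is the set of partitions of size $n$. The Young diagram is $Y_\lambda=\{(i,j): 1\le i\leq \ell(\lambda),\ 1\le j\leq\lambda_i\}$; its elements are called boxes. Write $\mu\subseteq\lambda$ if $Y_\mu\subseteq Y_\lambda$. A skew partition $\lambda/\mu$ is a pair of partitions $\mu\subseteq\lambda$, with Young diagram $Y_{\lambda/\mu}=Y_\lambda\setminus Y_\mu$. The top $t(\lambda/\mu)$ is $0$ if $\lambda=\mu$ and otherwise the least $i$ with $\lambda_i\ne\mu_i$; the bottom $b(\lambda/\mu)$ is $0$ if $\lambda=\mu$ and otherwise the greatest $i$ with $\lambda_i\neq\mu_i$. Border strips and signs. An $r$-border strip is a skew partition $\lambda/\mu$ whose diagram consists of $r$ boxes, is connected via edge-adjacency, and satisfies: for all $(i,j)\in Y_{\lambda/\mu}$, $(i+1,j+1)\notin Y_{\lambda/\mu}$. Its sign is $\operatorname{sgn}(\lambda/\mu)=(-1)^{b(\lambda/\mu)-t(\lambda/\mu)}$.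 A skew partition $\lambda/\mu$ is $r$-decomposable if there are $d\ge 0$ and partitions $\mu=\gamma^{(0)}\subseteq\gamma^{(1)}\subseteq\dots\subseteq\gamma^{(d)}=\lambda$ such that each $\gamma^{(i+1)}/\gamma^{(i)}$ ($0\le i\le d-1$) is an $r$-border strip and $t(\gamma^{(1)}/\gamma^{(0)})\geq t(\gamma^{(2)}/\gamma^{(1)})\geq\dots\geq t(\gamma^{(d)}/\gamma^{(d-1)})$; such a chain is unique if it exists. Define $\operatorname{sgn}_r(\lambda/\mu)=\prod_{i=1}^{d}\operatorname{sgn}(\gamma^{(i)}/\gamma^{(i-1)})$ if $\lambda/\mu$ is $r$-decomposable, and $\operatorname{sgn}_r(\lambda/\mu)=0$ otherwise. Symmetric functions. $s_\lambda$ is the Schur function; its specialisation to $N\ge\ell(\lambda)$ variables is the Schur polynomial $s_\lambda(x_1,\dots,x_N)=a_{\lambda+\delta(N)}/a_{\delta(N)}$, where $a_\beta=\det(x_i^{\beta_j})_{1\le i,j\le N}$ and $\delta(N)=(N-1,N-2,\dots,0)$. $h_m$ is the complete homogeneous symmetric function (the sum of all monomials of degree $m$), $p_r=\sum_i x_i^r$ is the power sum, and the plethysm $p_r\circ h_m$ is obtained from $h_m$ by replacing each variable $x_i$ by $x_i^r$. Since both sides are homogeneous of degree $|\mu|+rm$, the identity is equivalent to the corresponding identity of symmetric polynomials in $N$ variables for any $N\ge|\mu|+rm$. *)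

theory Defs
  imports
    "HOL-Library.Poly_Mapping"
    "HOL-Library.Function_Algebras"
    "Jordan_Normal_Form.Determinant"
begin

section \<open>Partitions and skew partitions\<close>

definition is_partition :: "nat list \<Rightarrow> bool" where
  "is_partition la \<longleftrightarrow> sorted_wrt (\<ge>) la \<and> (\<forall>p\<in>set la. 0 < p)"

definition Par :: "nat \<Rightarrow> nat list set" where
  "Par n = {la. is_partition la \<and> sum_list la = n}"

text \<open>Rows, columns and parts are numbered from 1, while lists are indexed from 0.\<close>

definition part :: "nat list \<Rightarrow> nat \<Rightarrow> nat" where
  "part la i = (if 1 \<le> i \<and> i \<le> length la then la ! (i - 1) else 0)"

definition young :: "nat list \<Rightarrow> (nat \<times> nat) set" where
  "young la = {(i, j). 1 \<le> i \<and> i \<le> length la \<and> 1 \<le> j \<and> j \<le> part la i}"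

definition par_subset :: "nat list \<Rightarrow> nat list \<Rightarrow> bool" where
  "par_subset mu la \<longleftrightarrow> young mu \<subseteq> young la"

text \<open>Throughout, a skew partition \<open>\<lambda>/\<mu>\<close> is passed as two arguments, \<open>\<lambda>\<close> first.\<close>

definition is_skew :: "nat list \<Rightarrow> nat list \<Rightarrow> bool" where
  "is_skew la mu \<longleftrightarrow> is_partition la \<and> is_partition mu \<and> par_subset mu la"

definition skew_young :: "nat list \<Rightarrow> nat list \<Rightarrow> (nat \<times> nat) set" where
  "skew_young la mu = young la - young mu"

definition skew_top :: "nat list \<Rightarrow> nat list \<Rightarrow> nat" where
  "skew_top la mu = (if la = mu then 0 else LEAST i. part la i \<noteq> part mu i)"

definition skew_bottom :: "nat list \<Rightarrow> nat list \<Rightarrow> nat" where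
  "skew_bottom la mu = (if la = mu then 0 else GREATEST i. part la i \<noteq> part mu i)"


section \<open>Border strips, decomposability and signs\<close>

definition edge_adjacent :: "nat \<times> nat \<Rightarrow> nat \<times> nat \<Rightarrow> bool" where
  "edge_adjacent a b \<longleftrightarrow>
     (fst a = fst b \<and> (snd a = snd b + 1 \<or> snd b = snd a + 1)) \<or>
     (snd a = snd b \<and> (fst a = fst b + 1 \<or> fst b = fst a + 1))"

definition edge_connected :: "(nat \<times> nat) set \<Rightarrow> bool" where
  "edge_connected S \<longleftrightarrow>
     (\<forall>a\<in>S. \<forall>b\<in>S. (a, b) \<in> {(c, d). c \<in> S \<and> d \<in> S \<and> edge_adjacent c d}\<^sup>*)"

definition border_strip :: "nat \<Rightarrow> nat list \<Rightarrow> nat list \<Rightarrow> bool" where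
  "border_strip r la mu \<longleftrightarrow>
     is_skew la mu \<and>
     card (skew_young la mu) = r \<and>
     edge_connected (skew_young la mu) \<and>
     (\<forall>(i, j)\<in>skew_young la mu. (i + 1, j + 1) \<notin> skew_young la mu)"

definition strip_sgn :: "nat list \<Rightarrow> nat list \<Rightarrow> int" where
  "strip_sgn la mu = (- 1) ^ (skew_bottom la mu - skew_top la mu)"

text \<open>The list \<open>gs\<close> is the chain \<open>\<gamma>\<^sup>(\<^sup>0\<^sup>), \<dots>, \<gamma>\<^sup>(\<^sup>d\<^sup>)\<close>, so \<open>d = length gs - 1\<close>.\<close>

definition strip_chain :: "nat \<Rightarrow> nat list \<Rightarrow> nat list \<Rightarrow> nat list list \<Rightarrow> bool" where
  "strip_chain r la mu gs \<longleftrightarrow>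
     gs \<noteq> [] \<and> hd gs = mu \<and> last gs = la \<and> (\<forall>g\<in>set gs. is_partition g) \<and>
     (\<forall>i. i + 1 < length gs \<longrightarrow> border_strip r (gs ! (i + 1)) (gs ! i)) \<and>
     (\<forall>i. i + 2 < length gs \<longrightarrow>
        skew_top (gs ! (i + 1)) (gs ! i) \<ge> skew_top (gs ! (i + 2)) (gs ! (i + 1)))"

definition decomposable :: "nat \<Rightarrow> nat list \<Rightarrow> nat list \<Rightarrow> bool" where
  "decomposable r la mu \<longleftrightarrow> (\<exists>gs. strip_chain r la mu gs)"

text \<open>For \<open>r > 0\<close> there is at most one such chain, so the choice below is immaterial.\<close>

definition sgn_r :: "nat \<Rightarrow> nat list \<Rightarrow> nat list \<Rightarrow> int" where
  "sgn_r r la mu =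
     (if decomposable r la mu
      then let gs = (SOME gs. strip_chain r la mu gs)
           in \<Prod>i = 1..length gs - 1. strip_sgn (gs ! i) (gs ! (i - 1))
      else 0)"


section \<open>Symmetric functions\<close>

text \<open>Integer polynomials in variables \<open>x\<^sub>1, x\<^sub>2, \<dots>\<close>: a monomial is a finitely supported
  exponent function.\<close>

type_synonym ipoly = "(nat \<Rightarrow>\<^sub>0 nat) \<Rightarrow>\<^sub>0 int"

definition X :: "nat \<Rightarrow> ipoly" where
  "X i = Poly_Mapping.single (Poly_Mapping.single i 1) 1"

definition poly_subst :: "(nat \<Rightarrow> ipoly) \<Rightarrow> ipoly \<Rightarrow> ipoly" where
  "poly_subst s p =
     (\<Sum>a\<in>Poly_Mapping.keys p. of_int (Poly_Mapping.lookup p a) *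
        (\<Prod>i\<in>Poly_Mapping.keys a. s i ^ Poly_Mapping.lookup a i))"

text \<open>The ring of symmetric functions is the inverse limit (in the category of graded rings) of
  the rings of symmetric polynomials in \<open>x\<^sub>1, \<dots>, x\<^sub>N\<close> along \<open>x\<^sub>N \<mapsto> 0\<close>. Its elements are
  represented by the families \<open>f\<close> of their specialisations \<open>f N\<close> to \<open>x\<^sub>1, \<dots>, x\<^sub>N\<close>; addition and
  multiplication are pointwise in \<open>N\<close>, as provided by \<open>HOL-Library.Function_Algebras\<close>.\<close>

type_synonym symfun = "nat \<Rightarrow> ipoly"

text \<open>\<open>alternant N \<beta>\<close> is \<open>a\<^sub>\<beta>\<close> with \<open>\<beta> = (\<beta> 1, \<dots>, \<beta> N)\<close>; the shift by \<open>Suc\<close> is due to matrix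
  indices starting at 0.\<close>

definition alternant :: "nat \<Rightarrow> (nat \<Rightarrow> nat) \<Rightarrow> ipoly" where
  "alternant N \<beta> = det (mat N N (\<lambda>(i, j). X (Suc i) ^ \<beta> (Suc j)))"

definition staircase :: "nat \<Rightarrow> nat \<Rightarrow> nat" where
  "staircase N j = N - j"

text \<open>The quotient \<open>a\<^bsub>\<lambda>+\<delta>(N)\<^esub> / a\<^bsub>\<delta>(N)\<^esub>\<close>, which is a polynomial and is unique because polynomials form
  an integral domain and \<open>a\<^bsub>\<delta>(N)\<^esub>\<close> is nonzero. Specialising \<open>s\<^sub>\<lambda>\<close> to fewer than \<open>\<ell>(\<lambda>)\<close> variables
  gives 0.\<close>

definition schur :: "nat list \<Rightarrow> symfun" where
  "schur la N =
     (if length la \<le> N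
      then THE s. s * alternant N (staircase N) = alternant N (\<lambda>j. part la j + staircase N j)
      else 0)"

definition complete_hom :: "nat \<Rightarrow> symfun" where
  "complete_hom m N =
     (\<Sum>a\<in>{a. Poly_Mapping.keys a \<subseteq> {1..N} \<and>
               (\<Sum>i\<in>Poly_Mapping.keys a. Poly_Mapping.lookup a i) = m}.
         Poly_Mapping.single a 1)"

text \<open>The plethysm \<open>p\<^sub>r \<circ> f\<close>: replace every variable \<open>x\<^sub>i\<close> of \<open>f\<close> by \<open>x\<^sub>i\<^sup>r\<close>.\<close>

definition power_plethysm :: "nat \<Rightarrow> symfun \<Rightarrow> symfun" where
  "power_plethysm r f N = poly_subst (\<lambda>i. X i ^ r) (f N)"

end

theory Submission
  imports Defs
begin

text \<open>Multiply by \<open>a\<^bsub>\<delta>(N)\<^esub>\<close>. As \<open>p\<^sub>r \<circ> h\<^sub>m\<close> is the sum of all \<open>x\<^bsup>r\<alpha>\<^esup>\<close> with \<open>|\<alpha>| = m\<close> and is symmetric, the left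
  side becomes the sum of the alternants \<open>a\<^bsub>\<beta>+r\<alpha>\<^esub>\<close>, where \<open>\<beta> = \<mu> + \<delta>(N)\<close>. Read \<open>\<beta>\<close> as positions of \<open>N\<close>
  beads, of which \<open>\<alpha>\<close> moves each by a multiple of \<open>r\<close>. The terms in which a bead reaches the original
  position of another bead of its residue class cancel in pairs. In the others, carry out the moves
  in single steps of length \<open>r\<close>, in increasing order of the target position. Each step adds an
  \<open>r\<close>-border strip whose top is the row of the moved bead, and re-sorting the beads costs the sign of
  the strip; increasing targets mean non-increasing tops. So the remaining terms correspond to the
  \<open>r\<close>-decomposable \<open>\<lambda>/\<mu>\<close>, and each equals \<open>sgn\<^sub>r(\<lambda>/\<mu>) a\<^bsub>\<lambda>+\<delta>(N)\<^esub>\<close>.\<close>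

section \<open>Alternants\<close>

text \<open>The Leibniz formula, transported along \<open>Suc\<close>: matrix indices start at 0,
  whereas variables and rows of partitions start at 1.\<close>

lemma alternant_expand:
  "alternant N f = (\<Sum>p | p permutes {1..N}. of_int (sign p) * (\<Prod>i\<in>{1..N}. X i ^ f (p i)))"
proof -
  let ?A = "{0..<N}" and ?B = "{1..N}"
  have bij: "bij_betw Suc ?A ?B" and bij': "bij_betw (\<lambda>i. i - 1) ?B ?A"
    by (auto intro!: bij_betw_byWitness[where f' = "\<lambda>i. i - 1"] bij_betw_byWitness[where f' = Suc])
  have "alternant N f =
      (\<Sum>p | p permutes ?A. of_int (sign p) * (\<Prod>i\<in>?A. X (Suc i) ^ f (Suc (p i))))"
    unfolding alternant_def by (subst det_def'[of _ N]) (auto intro!: sum.cong prod.cong)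
  also have "\<dots> = (\<Sum>p | p permutes ?B. of_int (sign p) * (\<Prod>i\<in>?B. X i ^ f (p i)))"
  proof (rule sum.reindex_bij_witness[where i = "map_permutation ?B (\<lambda>i. i - 1)"
        and j = "map_permutation ?A Suc"])
    fix p assume p: "p \<in> {p. p permutes ?A}"
    show "map_permutation ?B (\<lambda>i. i - 1) (map_permutation ?A Suc p) = p"
      using map_permutation_compose_inv[OF bij, of p "\<lambda>i. i - 1"] p by simp
    show "map_permutation ?A Suc p \<in> {p. p permutes ?B}"
      using map_permutation_permutes[OF bij] p by simp
    have "(\<Prod>i\<in>?B. X i ^ f (map_permutation ?A Suc p i)) =
        (\<Prod>i\<in>?A. X (Suc i) ^ f (map_permutation ?A Suc p (Suc i)))"
      by (rule prod.reindex_bij_betw[OF bij, symmetric])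
    also have "\<dots> = (\<Prod>i\<in>?A. X (Suc i) ^ f (Suc (p i)))"
      by (rule prod.cong) (auto simp: map_permutation_apply)
    finally show "of_int (sign (map_permutation ?A Suc p)) *
        (\<Prod>i\<in>?B. X i ^ f (map_permutation ?A Suc p i)) =
        of_int (sign p) * (\<Prod>i\<in>?A. X (Suc i) ^ f (Suc (p i)))"
      using p by (simp add: sign_map_permutation)
  next
    fix p assume p: "p \<in> {p. p permutes ?B}"
    show "map_permutation ?A Suc (map_permutation ?B (\<lambda>i. i - 1) p) = p"
      using map_permutation_compose_inv[OF bij', of p Suc] p by simp
    show "map_permutation ?B (\<lambda>i. i - 1) p \<in> {p. p permutes ?A}"
      using map_permutation_permutes[OF bij'] p by simp
  qed
  finally show ?thesis .
qed

lemma alternant_cong: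
  "(\<And>i. i \<in> {1..N} \<Longrightarrow> f i = g i) \<Longrightarrow> alternant N f = alternant N g"
  unfolding alternant_expand
  by (intro sum.cong prod.cong arg_cong2[where f = "(*)"] refl) (metis mem_Collect_eq permutes_in_image)

text \<open>Composing the summation index with \<open>q\<close> on the left permutes the terms of
  the Leibniz expansion and changes each sign by \<open>sign q\<close>. All later signs, those of
  cancelling pairs and those of border strips, come from this antisymmetry.\<close>

lemma alternant_permute:
  assumes q: "q permutes {1..N}"
  shows "alternant N (\<lambda>i. f (q i)) = of_int (sign q) * alternant N f"
proof -
  let ?t = "\<lambda>p. of_int (sign p) * (\<Prod>i\<in>{1..N}. X i ^ f (p i))"
  have perm: "permutation p" if "p permutes {1..N}" for p
    using that by (auto simp: permutation_permutes)
  have "of_int (sign q) * alternant N f = (\<Sum>p | p permutes {1..N}. of_int (sign q) * ?t (q \<circ> p))"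
    unfolding alternant_expand
    by (subst setum_permutations_compose_left[OF q]) (simp add: sum_distrib_left)
  also have "\<dots> = alternant N (\<lambda>i. f (q i))"
    unfolding alternant_expand
  proof (rule sum.cong)
    fix p assume p: "p \<in> {p. p permutes {1..N}}"
    have "sign q * sign (q \<circ> p) = sign p"
      using sign_compose[OF perm perm] p q by (simp add: sign_idempotent mult.assoc[symmetric])
    then have "of_int (sign q) * of_int (sign (q \<circ> p)) = (of_int (sign p) :: ipoly)"
      by (metis of_int_mult)
    then show "of_int (sign q) * ?t (q \<circ> p) = of_int (sign p) * (\<Prod>i\<in>{1..N}. X i ^ f (q (p i)))"
      by (simp add: mult.assoc[symmetric])
  qed simp
  finally show ?thesis ..
qed

lemma prod_X_power:
  "finite A \<Longrightarrow> (\<Prod>i\<in>A. X i ^ f i) =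
     Poly_Mapping.single (\<Sum>i\<in>A. Poly_Mapping.single i (f i)) 1"
proof (induction A rule: finite_induct)
  case (insert i A)
  have "X i ^ k = Poly_Mapping.single (Poly_Mapping.single i k) 1" for k
    by (induction k) (simp_all add: X_def mult_single single_add[symmetric])
  then show ?case using insert by (simp add: mult_single)
qed simp

lemma lookup_sum_single:
  "finite A \<Longrightarrow> Poly_Mapping.lookup (\<Sum>i\<in>A. Poly_Mapping.single i (f i)) j = (if j \<in> A then f j else 0)"
  by (simp add: lookup_sum lookup_single when_def)

text \<open>As the exponents are distinct, only the identity permutation yields the monomial with
  exponents \<open>f 1, ..., f N\<close>, whose coefficient is therefore 1.\<close>

lemma alternant_nonzero:
  assumes inj: "inj_on f {1..N}"
  shows "alternant N f \<noteq> 0"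
proof -
  let ?B = "{1..N}"
  let ?m = "\<lambda>p. \<Sum>i\<in>?B. Poly_Mapping.single i (f (p i))"
  have eq: "?m p = ?m id \<longleftrightarrow> p = id" if p: "p permutes ?B" for p
  proof
    assume h: "?m p = ?m id"
    show "p = id"
    proof
      fix i show "p i = id i"
      proof (cases "i \<in> ?B")
        case True
        then have "f (p i) = f i"
          using arg_cong[OF h, of "\<lambda>m. Poly_Mapping.lookup m i"] by (simp add: lookup_sum_single)
        then show ?thesis
          using inj True p by (metis id_apply inj_onD permutes_in_image)
      qed (use p in \<open>simp add: permutes_not_in\<close>)
    qed
  qed simp
  have "Poly_Mapping.lookup (alternant N f) (?m id) =
      (\<Sum>p | p permutes ?B. if p = id then 1 else 0)"
    unfolding alternant_expand lookup_sum
  proof (rule sum.cong)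
    fix p assume "p \<in> {p. p permutes ?B}"
    then have "?m p = ?m id \<longleftrightarrow> p = id" by (intro eq) simp
    then show "Poly_Mapping.lookup (of_int (sign p) * (\<Prod>i\<in>?B. X i ^ f (p i))) (?m id) =
        (if p = id then 1 else 0)"
      by (cases "p = id") (simp_all add: prod_X_power sign_def lookup_single when_def
          single_uminus[symmetric] del: single_uminus id_apply)
  qed simp
  also have "\<dots> = 1" by (simp add: finite_permutations permutes_id)
  finally show ?thesis by auto
qed

text \<open>Reducing \<open>t\<^sup>n\<close> modulo \<open>\<Prod>\<^sub>j (t - x\<^sub>j)\<close> expresses each row of the alternant matrix through the
  Vandermonde matrix, with the same coefficients for every variable.\<close>

lemma monic_product_coeffs:
  fixes x :: "nat \<Rightarrow> 'a :: comm_ring_1"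
  shows "\<exists>c. \<forall>t. (\<Prod>j<n. t - x j) = t ^ n - (\<Sum>k<n. c k * t ^ k)"
proof (induction n)
  case 0 then show ?case by simp
next
  case (Suc n)
  then obtain c where c: "(\<Prod>j<n. t - x j) = t ^ n - (\<Sum>k<n. c k * t ^ k)" for t by auto
  \<comment> \<open>The coefficients of \<open>t - x n\<close> times the previous product, with the
    leading power split off and the remaining signs reversed.\<close>
  define d where "d k = (if k = 0 then 0 else c (k - 1)) + (if k = n then x n else - x n * c k)" for k
  have "(\<Prod>j<Suc n. t - x j) = t ^ Suc n - (\<Sum>k<Suc n. d k * t ^ k)" for t
  proof -
    have 1: "(\<Sum>k<Suc n. (if k = 0 then 0 else c (k - 1)) * t ^ k) = (\<Sum>k<n. c k * t ^ Suc k)"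
      by (subst sum.lessThan_Suc_shift) simp
    have 2: "(\<Sum>k<Suc n. (if k = n then x n else - x n * c k) * t ^ k) =
        x n * t ^ n - x n * (\<Sum>k<n. c k * t ^ k)"
      by (simp add: sum_distrib_left sum_negf algebra_simps)
    show ?thesis
      unfolding d_def
      by (simp only: distrib_right sum.distrib 1 2 prod.lessThan_Suc c)
        (simp add: algebra_simps sum_distrib_left sum_subtractf)
  qed
  then show ?case by blast
qed

text \<open>Induction on \<open>n\<close>: multiplication by \<open>x i\<close> shifts the
  coefficients, and the overflowing \<open>x i ^ N\<close> is rewritten because \<open>x i\<close>
  is a root of the monic product. That \<open>c\<close> does not depend on \<open>i\<close> is what
  the matrix factorisation needs.\<close>

lemma power_reduction:
  fixes x :: "nat \<Rightarrow> 'a :: comm_ring_1"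
  shows "\<exists>c. \<forall>i<N. x i ^ n = (\<Sum>k<N. c k * x i ^ k)"
proof (induction n)
  case 0
  show ?case by (rule exI[of _ "\<lambda>k. if k = 0 then 1 else 0"]) (auto simp: if_distrib[of "\<lambda>y. y * _"] cong: if_cong)
next
  case (Suc n)
  then obtain c where c: "\<And>i. i < N \<Longrightarrow> x i ^ n = (\<Sum>k<N. c k * x i ^ k)" by auto
  obtain e where e: "(\<Prod>j<N. t - x j) = t ^ N - (\<Sum>k<N. e k * t ^ k)" for t
    using monic_product_coeffs[of x N] by auto
  define d where "d k = (if k = 0 then 0 else c (k - 1)) + c (N - 1) * e k" for k
  have "x i ^ Suc n = (\<Sum>k<N. d k * x i ^ k)" if i: "i < N" for i
  proof -
    obtain M where M: "N = Suc M" using i by (cases N) auto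
    have "(\<Prod>j<N. x i - x j) = 0" using i by (intro prod_zero) auto
    then have N: "x i ^ N = (\<Sum>k<N. e k * x i ^ k)" by (simp add: e)
    have "x i ^ Suc n = (\<Sum>k<M. c k * x i ^ Suc k) + c M * x i ^ N"
      by (simp add: c[OF i] M sum_distrib_left algebra_simps)
    also have "\<dots> = (\<Sum>k<Suc M. (if k = 0 then 0 else c (k - 1)) * x i ^ k) +
        c M * (\<Sum>k<N. e k * x i ^ k)"
      by (subst sum.lessThan_Suc_shift) (simp add: N)
    also have "\<dots> = (\<Sum>k<N. d k * x i ^ k)"
      by (simp add: d_def M sum_distrib_left sum.distrib distrib_right algebra_simps)
    finally show ?thesis .
  qed
  then show ?case by blast
qed

lemma alternant_dvd: "alternant N (staircase N) dvd alternant N f"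
proof -
  have "\<forall>n. \<exists>c. \<forall>i<N. X (Suc i) ^ n = (\<Sum>k<N. c k * X (Suc i) ^ k)"
    using power_reduction[of N "\<lambda>i. X (Suc i)"] by blast
  then obtain c where c: "\<And>n i. i < N \<Longrightarrow> X (Suc i) ^ n = (\<Sum>k<N. c n k * X (Suc i) ^ k)"
    by metis
  let ?V = "mat N N (\<lambda>(i, j). X (Suc i) ^ staircase N (Suc j))"
  \<comment> \<open>The index \<open>N - Suc k\<close> matches the decreasing powers in the columns
    of \<open>?V\<close>.\<close>
  let ?C = "mat N N (\<lambda>(k, j). c (f (Suc j)) (N - Suc k))"
  have "mat N N (\<lambda>(i, j). X (Suc i) ^ f (Suc j)) = ?V * ?C"
  proof (rule eq_matI)
    fix i j assume ij: "i < dim_row (?V * ?C)" "j < dim_col (?V * ?C)"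
    have "X (Suc i) ^ f (Suc j) = (\<Sum>k<N. c (f (Suc j)) k * X (Suc i) ^ k)"
      using ij by (intro c) simp
    also have "\<dots> = (\<Sum>k<N. c (f (Suc j)) (N - Suc k) * X (Suc i) ^ (N - Suc k))"
      by (rule sum.nat_diff_reindex[symmetric])
    also have "\<dots> = (?V * ?C) $$ (i, j)"
      using ij by (simp add: scalar_prod_def staircase_def atLeast0LessThan mult.commute)
    finally show "mat N N (\<lambda>(i, j). X (Suc i) ^ f (Suc j)) $$ (i, j) = (?V * ?C) $$ (i, j)"
      using ij by simp
  qed simp_all
  then show ?thesis
    unfolding alternant_def by (simp add: det_mult[of _ N])
qed

section \<open>Schur polynomials as quotients of alternants\<close>

lemma staircase_inj: "inj_on (staircase N) {1..N}"
  by (auto simp: inj_on_def staircase_def)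

text \<open>Divisibility gives a quotient, and cancelling the nonzero Vandermonde determinant makes
  it unique; so the definite description in \<open>schur\<close> denotes it.\<close>

lemma schur_times_vandermonde:
  assumes "length la \<le> N"
  shows "schur la N * alternant N (staircase N) = alternant N (\<lambda>j. part la j + staircase N j)"
proof -
  let ?d = "alternant N (staircase N)" and ?a = "alternant N (\<lambda>j. part la j + staircase N j)"
  obtain s where "s * ?d = ?a"
    using alternant_dvd[of N "\<lambda>j. part la j + staircase N j"] by (metis dvdE mult.commute)
  moreover have "t = s" if "t * ?d = ?a" "s * ?d = ?a" for s t
    using that alternant_nonzero[OF staircase_inj[of N]] by (metis mult_right_cancel)
  ultimately have "(THE s. s * ?d = ?a) * ?d = ?a" by (intro theI[of "\<lambda>s. s * ?d = ?a"])
  then show ?thesis using assms by (simp add: schur_def)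
qed


section \<open>Multiplying an alternant by the plethysm\<close>

text \<open>Vanishing outside \<open>{1..N}\<close> makes each composition a single function, so
  that sums over this set count it once.\<close>

definition weak_compositions :: "nat \<Rightarrow> nat \<Rightarrow> (nat \<Rightarrow> nat) set" where
  "weak_compositions N m = {w. (\<forall>i. i \<notin> {1..N} \<longrightarrow> w i = 0) \<and> (\<Sum>i\<in>{1..N}. w i) = m}"

lemma finite_weak_compositions: "finite (weak_compositions N m)"
proof (rule finite_subset)
  show "weak_compositions N m \<subseteq>
      {w. \<forall>i. (i \<in> {1..N} \<longrightarrow> w i \<in> {0..m}) \<and> (i \<notin> {1..N} \<longrightarrow> w i = 0)}"
    unfolding weak_compositions_def by (auto simp del: atLeastAtMost_iff) (auto intro: member_le_sum)
  show "finite \<dots>" by (rule finite_set_of_finite_funs) auto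
qed

text \<open>All monomials of the complete homogeneous polynomial have coefficient 1. Their exponent
  functions are exactly the weak compositions, whose support is finite because it lies in
  \<open>{1..N}\<close>.\<close>

lemma power_plethysm_complete_hom:
  "power_plethysm r (complete_hom m) N =
     (\<Sum>w\<in>weak_compositions N m. \<Prod>i\<in>{1..N}. X i ^ (r * w i))"
proof -
  define K where "K = {a. Poly_Mapping.keys a \<subseteq> {1..N} \<and>
               (\<Sum>i\<in>Poly_Mapping.keys a. Poly_Mapping.lookup a i) = m}"
  have sum_keys: "(\<Sum>i\<in>Poly_Mapping.keys a. Poly_Mapping.lookup a i) =
      (\<Sum>i\<in>{1..N}. Poly_Mapping.lookup a i)" if "Poly_Mapping.keys a \<subseteq> {1..N}" for a :: "nat \<Rightarrow>\<^sub>0 nat"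
    by (rule sum.mono_neutral_left) (use that in \<open>auto simp: in_keys_iff\<close>)
  have bij: "bij_betw Poly_Mapping.lookup K (weak_compositions N m)"
  proof (rule bij_betw_imageI)
    show "inj_on Poly_Mapping.lookup K"
      by (rule inj_onI) (rule poly_mapping_eqI, simp)
    show "Poly_Mapping.lookup ` K = weak_compositions N m"
    proof (intro equalityI subsetI)
      fix w assume "w \<in> Poly_Mapping.lookup ` K"
      then obtain a where a: "w = Poly_Mapping.lookup a" "Poly_Mapping.keys a \<subseteq> {1..N}"
        "(\<Sum>i\<in>Poly_Mapping.keys a. Poly_Mapping.lookup a i) = m" unfolding K_def by blast
      have "w i = 0" if "i \<notin> {1..N}" for i
        using a(1,2) that by (meson in_keys_iff subsetD)
      then show "w \<in> weak_compositions N m"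
        using a sum_keys[OF a(2)] by (simp add: weak_compositions_def)
    next
      fix w assume w: "w \<in> weak_compositions N m"
      then have w0: "w i = 0" if "i \<notin> {1..N}" for i
        using that unfolding weak_compositions_def mem_Collect_eq by blast
      have "{i. w i \<noteq> 0} \<subseteq> {1..N}"
      proof (rule subsetI, rule ccontr)
        fix i assume "i \<in> {i. w i \<noteq> 0}" "i \<notin> {1..N}"
        then show False using w0[of i] by simp
      qed
      then have "finite {i. w i \<noteq> 0}" by (rule finite_subset) simp
      then have l: "Poly_Mapping.lookup (Poly_Mapping.Abs_poly_mapping w) = w"
        by (intro Poly_Mapping.Abs_poly_mapping_inverse CollectI)
      have k: "Poly_Mapping.keys (Poly_Mapping.Abs_poly_mapping w) \<subseteq> {1..N}"
      proof
        fix i assume "i \<in> Poly_Mapping.keys (Poly_Mapping.Abs_poly_mapping w)"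
        then have "w i \<noteq> 0" unfolding in_keys_iff l .
        then show "i \<in> {1..N}" using w0[of i] by (rule contrapos_np)
      qed
      have "Poly_Mapping.Abs_poly_mapping w \<in> K"
        using w sum_keys[OF k] k by (simp add: K_def l weak_compositions_def)
      then show "w \<in> Poly_Mapping.lookup ` K" by (rule rev_image_eqI) (rule l[symmetric])
    qed
  qed
  then have fin: "finite K"
    using finite_weak_compositions bij_betw_finite by blast
  have lookup: "Poly_Mapping.lookup (complete_hom m N) a = (if a \<in> K then 1 else 0)" for a
  proof -
    have "Poly_Mapping.lookup (complete_hom m N) a = (\<Sum>x\<in>K. if x = a then 1 else 0)"
      unfolding complete_hom_def lookup_sum K_def by (simp only: lookup_single when_def)
    then show ?thesis by (simp only: sum.delta[OF fin])
  qed
  then have keys: "Poly_Mapping.keys (complete_hom m N) = K"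
    by (auto simp: in_keys_iff split: if_splits)
  have "power_plethysm r (complete_hom m) N =
      (\<Sum>a\<in>K. \<Prod>i\<in>{1..N}. X i ^ (r * Poly_Mapping.lookup a i))"
    unfolding power_plethysm_def poly_subst_def keys
  proof (rule sum.cong)
    fix a assume a: "a \<in> K"
    have "(\<Prod>i\<in>Poly_Mapping.keys a. (X i ^ r) ^ Poly_Mapping.lookup a i) =
        (\<Prod>i\<in>{1..N}. X i ^ (r * Poly_Mapping.lookup a i))"
      unfolding power_mult
      by (rule prod.mono_neutral_left) (use a in \<open>auto simp: K_def in_keys_iff\<close>)
    then show "of_int (Poly_Mapping.lookup (complete_hom m N) a) *
        (\<Prod>i\<in>Poly_Mapping.keys a. (X i ^ r) ^ Poly_Mapping.lookup a i) =
        (\<Prod>i\<in>{1..N}. X i ^ (r * Poly_Mapping.lookup a i))"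
      using a by (simp add: lookup)
  qed simp
  also have "\<dots> = (\<Sum>w\<in>weak_compositions N m. \<Prod>i\<in>{1..N}. X i ^ (r * w i))"
    using sum.reindex_bij_betw[OF bij, of "\<lambda>w. \<Prod>i\<in>{1..N}. X i ^ (r * w i)"] by simp
  finally show ?thesis .
qed

text \<open>The power sum plethysm is symmetric, so it may be multiplied into each term of the Leibniz
  expansion after permuting its exponents along.\<close>

lemma alternant_times_plethysm:
  "alternant N b * power_plethysm r (complete_hom m) N =
     (\<Sum>w\<in>weak_compositions N m. alternant N (\<lambda>i. b i + r * w i))"
proof -
  let ?W = "weak_compositions N m"
  \<comment> \<open>Permuting the entries is a bijection of the weak compositions; this is the
    symmetry of the plethysm.\<close>
  have perm: "(\<Sum>w\<in>?W. F w) = (\<Sum>w\<in>?W. F (w \<circ> p))" if p: "p permutes {1..N}"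
    for p and F :: "(nat \<Rightarrow> nat) \<Rightarrow> ipoly"
  proof -
    have closed: "w \<circ> q \<in> ?W" if q: "q permutes {1..N}" and "w \<in> ?W" for q w
      using that(2) sum.permute[OF q, of w] permutes_not_in[OF q]
      by (auto simp: weak_compositions_def)
    show ?thesis
      by (rule sum.reindex_bij_witness[where i = "\<lambda>w. w \<circ> p" and j = "\<lambda>w. w \<circ> inv_into UNIV p"])
        (simp_all add: closed[OF p] closed[OF permutes_inv[OF p]] comp_assoc permutes_inv_o[OF p])
  qed
  have "alternant N b * power_plethysm r (complete_hom m) N =
      (\<Sum>p | p permutes {1..N}. \<Sum>w\<in>?W.
        of_int (sign p) * (\<Prod>i\<in>{1..N}. X i ^ (b (p i) + r * w i)))"
    unfolding alternant_expand power_plethysm_complete_hom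
    by (simp add: sum_product power_add prod.distrib mult.assoc)
  also have "\<dots> = (\<Sum>p | p permutes {1..N}. \<Sum>w\<in>?W.
        of_int (sign p) * (\<Prod>i\<in>{1..N}. X i ^ (b (p i) + r * w (p i))))"
  proof (rule sum.cong[OF refl])
    fix p assume p: "p \<in> {p. p permutes {1..N}}"
    show "(\<Sum>w\<in>?W. of_int (sign p) * (\<Prod>i\<in>{1..N}. X i ^ (b (p i) + r * w i))) =
        (\<Sum>w\<in>?W. of_int (sign p) * (\<Prod>i\<in>{1..N}. X i ^ (b (p i) + r * w (p i))))"
      using perm[of p "\<lambda>w. of_int (sign p) * (\<Prod>i\<in>{1..N}. X i ^ (b (p i) + r * w i))"] p by simp
  qed
  also have "\<dots> = (\<Sum>w\<in>?W. alternant N (\<lambda>i. b i + r * w i))"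
    unfolding alternant_expand by (rule sum.swap)
  finally show ?thesis .
qed

text \<open>Positions of the labelled beads after moving them by \<open>m\<close> steps of length \<open>r\<close> in total,
  starting from the positions \<open>b\<close>.\<close>

definition bead_moves :: "nat \<Rightarrow> nat \<Rightarrow> (nat \<Rightarrow> nat) \<Rightarrow> nat \<Rightarrow> (nat \<Rightarrow> nat) set" where
  "bead_moves r N b m =
     {g. (\<forall>i. i \<notin> {1..N} \<longrightarrow> g i = 0) \<and> (\<forall>i\<in>{1..N}. b i \<le> g i \<and> g i mod r = b i mod r) \<and>
         (\<Sum>i\<in>{1..N}. g i) = (\<Sum>i\<in>{1..N}. b i) + r * m}"

text \<open>For distinct starting positions and \<open>g\<close> in \<open>bead_moves\<close>, this
  says that in each residue class modulo \<open>r\<close> the intervals from \<open>b i\<close> to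
  \<open>g i\<close> swept by the beads are disjoint.\<close>

definition noncrossing :: "nat \<Rightarrow> nat \<Rightarrow> (nat \<Rightarrow> nat) \<Rightarrow> (nat \<Rightarrow> nat) \<Rightarrow> bool" where
  "noncrossing r N b g \<longleftrightarrow>
     (\<forall>i\<in>{1..N}. \<forall>j\<in>{1..N}. b j < b i \<and> b j mod r = b i mod r \<longrightarrow> g j < b i)"

text \<open>The bijection sends \<open>w\<close> to \<open>b + r w\<close>. Congruence modulo
  \<open>r\<close> makes the division by \<open>r\<close> in its inverse exact.\<close>

lemma sum_alternant_bead_moves:
  assumes "0 < r"
  shows "(\<Sum>w\<in>weak_compositions N m. alternant N (\<lambda>i. b i + r * w i)) =
    (\<Sum>g\<in>bead_moves r N b m. alternant N g)"
proof (rule sum.reindex_bij_witness[where j = "\<lambda>w i. if i \<in> {1..N} then b i + r * w i else 0"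
      and i = "\<lambda>g i. if i \<in> {1..N} then (g i - b i) div r else 0"])
  fix g assume g: "g \<in> bead_moves r N b m"
  then have le: "b i \<le> g i" and md: "g i mod r = b i mod r" if "i \<in> {1..N}" for i
    using that unfolding bead_moves_def by blast+
  have eq: "r * ((g i - b i) div r) = g i - b i" if "i \<in> {1..N}" for i
  proof -
    have "r dvd g i - b i" using mod_eq_dvd_iff_nat[OF le[OF that]] md[OF that] by blast
    then show ?thesis by (rule dvd_mult_div_cancel)
  qed
  show "(\<lambda>i. if i \<in> {1..N} then b i + r * (if i \<in> {1..N} then (g i - b i) div r else 0) else 0) = g"
  proof
    fix i show "(if i \<in> {1..N} then b i + r * (if i \<in> {1..N} then (g i - b i) div r else 0) else 0) = g i"
      using g eq[of i] le[of i] by (auto simp: bead_moves_def)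
  qed
  have "(\<Sum>i\<in>{1..N}. g i) = (\<Sum>i\<in>{1..N}. b i + r * ((g i - b i) div r))"
    using eq le by (intro sum.cong) auto
  then have "r * (\<Sum>i\<in>{1..N}. (g i - b i) div r) = r * m"
    using g by (simp add: bead_moves_def sum.distrib sum_distrib_left)
  then show "(\<lambda>i. if i \<in> {1..N} then (g i - b i) div r else 0) \<in> weak_compositions N m"
    using assms by (simp add: weak_compositions_def)
next
  fix w assume w: "w \<in> weak_compositions N m"
  show "(\<lambda>i. if i \<in> {1..N} then ((if i \<in> {1..N} then b i + r * w i else 0) - b i) div r else 0) = w"
    using w assms by (auto simp: weak_compositions_def)
  show "(\<lambda>i. if i \<in> {1..N} then b i + r * w i else 0) \<in> bead_moves r N b m"
    using w by (simp add: bead_moves_def weak_compositions_def sum.distrib sum_distrib_left[symmetric])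
  show "alternant N (\<lambda>i. if i \<in> {1..N} then b i + r * w i else 0) = alternant N (\<lambda>i. b i + r * w i)"
    by (rule alternant_cong) simp
qed

lemma finite_bead_moves:
  "finite (bead_moves r N b m)"
proof (rule finite_subset)
  show "bead_moves r N b m \<subseteq> weak_compositions N ((\<Sum>i\<in>{1..N}. b i) + r * m)"
    by (auto simp: bead_moves_def weak_compositions_def)
qed (rule finite_weak_compositions)

text \<open>Crossing configurations cancel in pairs: swap the last bead \<open>j\<close> that has reached the original
  position of a larger bead in its residue class with the bead preceding \<open>j\<close> in that class.\<close>

lemma sum_alternant_crossing:
  assumes dec: "\<And>i j. 1 \<le> i \<Longrightarrow> i < j \<Longrightarrow> j \<le> N \<Longrightarrow> b j < b i"
  shows "(\<Sum>g | g \<in> bead_moves r N b m \<and> \<not> noncrossing r N b g. alternant N g) = 0"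
proof -
  \<comment> \<open>Since \<open>b\<close> decreases, larger beads have smaller indices; hence
    \<open>pre j\<close>, the next larger bead of the class of \<open>j\<close>, is a maximum of
    indices.\<close>
  define viol where "viol g j \<longleftrightarrow> j \<le> N \<and>
    (\<exists>i. 1 \<le> i \<and> i < j \<and> b i mod r = b j mod r \<and> b i \<le> g j)" for g :: "nat \<Rightarrow> nat" and j
  define pre where "pre j = Max {i. 1 \<le> i \<and> i < j \<and> b i mod r = b j mod r}" for j
  define jm where "jm g = Max {j. viol g j}" for g
  define T where "T g = g \<circ> transpose (pre (jm g)) (jm g)" for g
  let ?Bad = "{g. g \<in> bead_moves r N b m \<and> \<not> noncrossing r N b g}"
  have b_le: "b j < b i \<longleftrightarrow> i < j" if "i \<in> {1..N}" "j \<in> {1..N}" for i j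
    using dec[of i j] dec[of j i] that by (cases i j rule: linorder_cases) auto
  have bad_iff: "\<not> noncrossing r N b g \<longleftrightarrow> (\<exists>j. viol g j)" for g
    unfolding noncrossing_def viol_def using b_le
    by (smt (verit, ccfv_threshold) atLeastAtMost_iff le_trans less_imp_le not_less)
  have jm_eqI: "jm g = j" if "viol g j" "\<And>k. j < k \<Longrightarrow> \<not> viol g k" for g j
    unfolding jm_def
    by (rule Max_eqI) (use that in \<open>auto simp: viol_def not_less[symmetric] intro: finite_subset[of _ "{..N}"]\<close>)
  have jm: "viol g (jm g)" "\<And>k. jm g < k \<Longrightarrow> \<not> viol g k" if "\<exists>j. viol g j" for g
  proof -
    have fin: "finite {j. viol g j}" by (rule finite_subset[of _ "{..N}"]) (auto simp: viol_def)
    show "viol g (jm g)" using Max_in[OF fin] that by (auto simp: jm_def)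
    show "\<not> viol g k" if "jm g < k" for k
      using Max_ge[OF fin, of k] that by (auto simp: jm_def)
  qed
  have pre: "1 \<le> pre j" "pre j < j" "b (pre j) mod r = b j mod r" "b (pre j) \<le> g j" if v: "viol g j" for g j
  proof -
    let ?S = "{i. 1 \<le> i \<and> i < j \<and> b i mod r = b j mod r}"
    have fin: "finite ?S" by (rule finite_subset[of _ "{..j}"]) auto
    obtain i where i: "i \<in> ?S" "b i \<le> g j" "j \<le> N" using v by (auto simp: viol_def)
    have P: "pre j \<in> ?S" unfolding pre_def using i fin by (intro Max_in) auto
    then show "1 \<le> pre j" "pre j < j" "b (pre j) mod r = b j mod r" by auto
    have "i \<le> pre j" unfolding pre_def using i fin by (intro Max_ge) auto
    then have "b (pre j) \<le> b i" using P i dec[of i "pre j"] by (cases "i = pre j") auto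
    then show "b (pre j) \<le> g j" using i by simp
  qed
  have main: "T g \<in> ?Bad" "T (T g) = g" "alternant N (T g) = - alternant N g" if g: "g \<in> ?Bad" for g
  proof -
    let ?j = "jm g" and ?i = "pre (jm g)"
    have v: "viol g ?j" "\<And>k. ?j < k \<Longrightarrow> \<not> viol g k" using jm g bad_iff by auto
    note p = pre[OF v(1)]
    have jN: "?j \<le> N" using v(1) by (simp add: viol_def)
    have gi: "b ?i \<le> g ?i" "g ?i mod r = b ?i mod r" "g ?j mod r = b ?j mod r"
      using g p jN by (auto simp: bead_moves_def)
    have Tj: "T g ?j = g ?i" and Ti: "T g ?i = g ?j" and Tk: "\<And>k. k \<noteq> ?i \<Longrightarrow> k \<noteq> ?j \<Longrightarrow> T g k = g k"
      by (simp_all add: T_def)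
    \<comment> \<open>Bead \<open>?j\<close> now stands at \<open>g ?i\<close>, which is at least
      the start of \<open>?i\<close>, so it still violates; later beads are untouched. Hence the
      same pair is chosen again and \<open>T\<close> is an involution.\<close>
    have vT: "viol (T g) ?j" using v(1) p gi Tj unfolding viol_def by metis
    have nT: "\<not> viol (T g) k" if "?j < k" for k
      using v(2)[OF that] that p Tk[of k] by (auto simp: viol_def)
    have jT: "jm (T g) = ?j" using vT nT by (rule jm_eqI)
    show "T (T g) = g" unfolding T_def[of "T g"] jT by (simp add: T_def comp_assoc)
    have tp: "transpose ?i ?j permutes {1..N}" using p jN by (intro permutes_swap_id) auto
    have bji: "b ?j \<le> b ?i" using dec[of ?i ?j] p jN by simp
    have "T g \<in> bead_moves r N b m"
      unfolding bead_moves_def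
    proof (intro CollectI conjI allI impI ballI)
      show "T g k = 0" if "k \<notin> {1..N}" for k
        using that g permutes_not_in[OF tp that] by (simp add: T_def bead_moves_def)
      have "b ?j \<le> g ?i" using bji gi by simp
      then show "b k \<le> T g k" if "k \<in> {1..N}" for k
        using that g p Ti Tj Tk[of k] by (cases "k = ?i"; cases "k = ?j") (auto simp: bead_moves_def)
      show "T g k mod r = b k mod r" if "k \<in> {1..N}" for k
        using that g gi p bji Ti Tj Tk[of k] by (cases "k = ?i"; cases "k = ?j") (auto simp: bead_moves_def)
      show "sum (T g) {1..N} = sum b {1..N} + r * m"
        using sum.permute[OF tp, of g] g unfolding T_def by (simp add: bead_moves_def)
    qed
    then show "T g \<in> ?Bad" using bad_iff vT by auto
    have "alternant N (T g) = of_int (sign (transpose ?i ?j)) * alternant N g"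
      using alternant_permute[OF tp, of g] by (simp add: T_def comp_def)
    then show "alternant N (T g) = - alternant N g" using p by (simp add: sign_swap_id)
  qed
  have "(\<Sum>g\<in>?Bad. alternant N g) = (\<Sum>g\<in>?Bad. - alternant N g)"
    by (rule sum.reindex_bij_witness[where i = T and j = T]) (use main in auto)
  then have "2 * (\<Sum>g\<in>?Bad. alternant N g) = 0" by (simp add: sum_negf)
  then show ?thesis by simp
qed

lemma alternant_times_plethysm_noncrossing:
  assumes "0 < r" and dec: "\<And>i j. 1 \<le> i \<Longrightarrow> i < j \<Longrightarrow> j \<le> N \<Longrightarrow> b j < b i"
  shows "alternant N b * power_plethysm r (complete_hom m) N =
    (\<Sum>g | g \<in> bead_moves r N b m \<and> noncrossing r N b g. alternant N g)"
proof -
  let ?M = "bead_moves r N b m"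
  have "(\<Sum>g\<in>?M. alternant N g) = (\<Sum>g\<in>?M \<inter> {g. noncrossing r N b g}. alternant N g) +
      (\<Sum>g\<in>?M - {g. noncrossing r N b g}. alternant N g)"
    by (rule sum.Int_Diff[OF finite_bead_moves])
  moreover have "?M - {g. noncrossing r N b g} = {g. g \<in> ?M \<and> \<not> noncrossing r N b g}"
    "?M \<inter> {g. noncrossing r N b g} = {g. g \<in> ?M \<and> noncrossing r N b g}" by auto
  ultimately show ?thesis
    using sum_alternant_crossing[OF dec] assms
    by (simp add: alternant_times_plethysm sum_alternant_bead_moves)
qed


section \<open>Border strips\<close>

lemma part_gt_length: "length la < i \<Longrightarrow> part la i = 0"
  by (simp add: part_def)

lemma part_0 [simp]: "part la 0 = 0"
  by (simp add: part_def)

lemma part_pos_iff: "is_partition la \<Longrightarrow> 0 < part la i \<longleftrightarrow> 1 \<le> i \<and> i \<le> length la"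
  by (auto simp: part_def is_partition_def)

lemma part_antimono:
  assumes "is_partition la" "1 \<le> i" "i \<le> j"
  shows "part la j \<le> part la i"
  using assms sorted_wrt_nth_less[of "(\<ge>)" la "i - 1" "j - 1"]
  by (cases "i = j") (auto simp: part_def is_partition_def)

lemma mem_young: "(i, j) \<in> young la \<longleftrightarrow> 1 \<le> i \<and> 1 \<le> j \<and> j \<le> part la i"
  by (auto simp: young_def part_def split: if_splits)

lemma par_subset_iff: "par_subset mu la \<longleftrightarrow> (\<forall>i. part mu i \<le> part la i)"
proof
  assume s: "par_subset mu la"
  show "\<forall>i. part mu i \<le> part la i"
  proof
    fix i show "part mu i \<le> part la i"
    proof (cases "part mu i = 0")
      case False
      then have "(i, part mu i) \<in> young mu" by (auto simp: mem_young part_def split: if_splits)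
      then have "(i, part mu i) \<in> young la" using s by (auto simp: par_subset_def)
      then show ?thesis by (simp add: mem_young)
    qed simp
  qed
next
  assume "\<forall>i. part mu i \<le> part la i"
  then show "par_subset mu la"
    unfolding par_subset_def by (auto simp: mem_young) (meson le_trans)
qed

lemma partition_eqI:
  assumes "is_partition la" "is_partition mu" "\<And>i. part la i = part mu i"
  shows "la = mu"
proof (rule nth_equalityI)
  have "i < length la \<longleftrightarrow> i < length mu" for i
    using part_pos_iff[OF assms(1), of "Suc i"] part_pos_iff[OF assms(2), of "Suc i"] assms(3)
    by auto
  then show len: "length la = length mu" by (meson linorder_neq_iff)
  show "la ! i = mu ! i" if "i < length la" for i
    using assms(3)[of "Suc i"] that len by (simp add: part_def)
qed

lemma sum_part: "length la \<le> N \<Longrightarrow> (\<Sum>i\<in>{1..N}. part la i) = sum_list la"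
proof -
  assume "length la \<le> N"
  then have "(\<Sum>i\<in>{1..N}. part la i) = (\<Sum>i\<in>{1..length la}. part la i)"
    by (intro sum.mono_neutral_right) (auto simp: part_gt_length)
  also have "\<dots> = (\<Sum>i<length la. la ! i)"
    by (rule sum.reindex_bij_witness[where i = Suc and j = "\<lambda>i. i - 1"]) (auto simp: part_def)
  also have "\<dots> = sum_list la" by (simp add: sum_list_sum_nth atLeast0LessThan)
  finally show ?thesis .
qed

lemma card_young: "finite (young la)" "card (young la) = sum_list la"
proof -
  have eq: "young la = Sigma {1..length la} (\<lambda>i. {1..part la i})"
    by (auto simp: young_def)
  show "finite (young la)" unfolding eq by simp
  show "card (young la) = sum_list la" unfolding eq using sum_part[of la "length la"] by simp
qed

lemma card_skew_young:
  assumes "par_subset mu la"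
  shows "card (skew_young la mu) = sum_list la - sum_list mu" "sum_list mu \<le> sum_list la"
  using assms card_mono[of "young la" "young mu"]
  by (simp_all add: skew_young_def par_subset_def card_Diff_subset card_young)

lemma length_mono:
  assumes "is_partition mu" "is_partition la" "par_subset mu la"
  shows "length mu \<le> length la"
proof (cases "length mu = 0")
  case False
  then have "0 < part mu (length mu)" using part_pos_iff[OF assms(1)] by (simp add: Suc_leI)
  then have "0 < part la (length mu)" using assms(3) by (auto simp: par_subset_iff intro: less_le_trans)
  then show ?thesis using part_pos_iff[OF assms(2)] by simp
qed simp

section \<open>The rows of a border strip\<close>

lemma mem_skew_young:
  "(i, j) \<in> skew_young la mu \<longleftrightarrow> 1 \<le> i \<and> part mu i < j \<and> j \<le> part la i"
  by (auto simp: skew_young_def mem_young)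

text \<open>Encodes a border strip in rows \<open>t\<close> to \<open>b\<close>: row
  \<open>Suc i\<close> of the strip ends in the column where row \<open>i\<close> begins, so
  consecutive rows share exactly one column. Row \<open>t\<close> may have any positive
  length.\<close>

definition strip_shape :: "nat list \<Rightarrow> nat list \<Rightarrow> nat \<Rightarrow> nat \<Rightarrow> bool" where
  "strip_shape la mu t b \<longleftrightarrow> 1 \<le> t \<and> t \<le> b \<and> part mu t < part la t \<and>
     (\<forall>i. i < t \<or> b < i \<longrightarrow> part la i = part mu i) \<and>
     (\<forall>i. t \<le> i \<and> i < b \<longrightarrow> part la (Suc i) = Suc (part mu i))"

text \<open>A discrete intermediate value argument: an edge changes the row by at most one, and only
  within a column, so a path from a row at most \<open>i\<close> to a row beyond \<open>i\<close>
  contains a vertical edge from row \<open>i\<close> to the next.\<close>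

lemma connected_crosses_row:
  assumes "(x, y) \<in> {(c, d). c \<in> S \<and> d \<in> S \<and> edge_adjacent c d}\<^sup>*"
    and "fst x \<le> i" "i < fst y"
  shows "\<exists>j. (i, j) \<in> S \<and> (Suc i, j) \<in> S"
  using assms
proof (induction rule: rtrancl_induct)
  case (step y z)
  then show ?case
    by (cases "i < fst y"; cases y; cases z) (auto simp: edge_adjacent_def less_Suc_eq)
qed simp

text \<open>Connectedness forces consecutive rows of the strip to share a column; the absence of
  diagonal neighbours restricts them to one.\<close>

lemma border_strip_shape:
  assumes bs: "border_strip r la mu" and r: "0 < r"
  shows "strip_shape la mu (skew_top la mu) (skew_bottom la mu)"
proof -
  let ?S = "skew_young la mu"
  let ?P = "\<lambda>i. part la i \<noteq> part mu i"
  have part: "is_partition la" "is_partition mu" and sub: "\<And>i. part mu i \<le> part la i"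
    using bs by (auto simp: border_strip_def is_skew_def par_subset_iff)
  have ne: "la \<noteq> mu" using bs r by (auto simp: border_strip_def skew_young_def)
  then obtain i0 where i0: "?P i0" using partition_eqI part by blast
  have bound: "i \<le> length la" if "?P i" for i
    using that sub[of i] part_gt_length[of la i] by (cases "length la < i") auto
  define t where "t = skew_top la mu"
  define b where "b = skew_bottom la mu"
  have t: "t = (LEAST i. ?P i)" and b: "b = (GREATEST i. ?P i)"
    using ne by (auto simp: t_def b_def skew_top_def skew_bottom_def)
  have Pt: "?P t" unfolding t using i0 by (rule LeastI)
  have Pb: "?P b" unfolding b using i0 bound by (rule GreatestI_nat)
  have tl: "\<And>i. ?P i \<Longrightarrow> t \<le> i" unfolding t by (rule Least_le)
  have bg: "\<And>i. ?P i \<Longrightarrow> i \<le> b" unfolding b by (rule Greatest_le_nat[OF _ bound])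
  have t1: "1 \<le> t" using Pt by (cases t) auto
  have box: "(t, part la t) \<in> ?S" "(b, part la b) \<in> ?S"
    using Pt Pb sub[of t] sub[of b] t1 tl[OF Pb] by (auto simp: mem_skew_young)
  have path: "((t, part la t), (b, part la b)) \<in> {(c, d). c \<in> ?S \<and> d \<in> ?S \<and> edge_adjacent c d}\<^sup>*"
  proof -
    have "edge_connected ?S" using bs by (simp add: border_strip_def)
    from this[unfolded edge_connected_def, rule_format, OF box] show ?thesis .
  qed
  have step: "part la (Suc i) = Suc (part mu i)" if i: "t \<le> i" "i < b" for i
  proof -
    obtain j where j: "(i, j) \<in> ?S" "(Suc i, j) \<in> ?S"
      using connected_crosses_row[OF path] i by auto
    then have "(i, Suc (part mu i)) \<in> ?S" by (auto simp: mem_skew_young)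
    then have "(i + 1, Suc (part mu i) + 1) \<notin> ?S" using bs unfolding border_strip_def by blast
    moreover have "part mu (Suc i) \<le> part mu i" using part_antimono[OF part(2), of i "Suc i"] i t1 by simp
    ultimately show ?thesis using j by (auto simp: mem_skew_young)
  qed
  show ?thesis
    unfolding t_def[symmetric] b_def[symmetric] strip_shape_def
    using t1 tl[OF Pb] Pt sub[of t] step tl bg by (auto simp: not_less[symmetric])
qed

text \<open>For connectedness, every box is joined to the leftmost box of its row, and the leftmost
  boxes of consecutive rows are joined through the column that these rows share.\<close>

lemma shape_border_strip:
  assumes part: "is_partition la" "is_partition mu" and sh: "strip_shape la mu t b"
    and size: "sum_list la = sum_list mu + r"
  shows "border_strip r la mu" "skew_top la mu = t" "skew_bottom la mu = b"
proof -
  let ?S = "skew_young la mu"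
  let ?R = "{(c, d). c \<in> ?S \<and> d \<in> ?S \<and> edge_adjacent c d}"
  have t1: "1 \<le> t" "t \<le> b" and out: "\<And>i. i < t \<or> b < i \<Longrightarrow> part la i = part mu i"
    and step: "\<And>i. t \<le> i \<Longrightarrow> i < b \<Longrightarrow> part la (Suc i) = Suc (part mu i)"
    and top: "part mu t < part la t"
    using sh by (auto simp: strip_shape_def)
  have mu_dec: "part mu (Suc i) \<le> part mu i" if "1 \<le> i" for i
    using part_antimono[OF part(2), of i "Suc i"] that by simp
  have inside: "part mu i < part la i" if i: "t \<le> i" "i \<le> b" for i
  proof (cases "i = t")
    case False
    then obtain k where k: "i = Suc k" "t \<le> k" using i by (cases i) auto
    then show ?thesis using step[of k] mu_dec[of k] i t1 by simp
  qed (simp add: top)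
  have rows: "t \<le> i \<and> i \<le> b" if "(i, j) \<in> ?S" for i j
    using that out[of i] by (auto simp: mem_skew_young not_less[symmetric])
  have sub: "part mu i \<le> part la i" for i
    using inside[of i] out[of i] by (cases "t \<le> i \<and> i \<le> b") auto
  then have skew: "is_skew la mu" using part by (simp add: is_skew_def par_subset_iff)
  have "sym ?R" by (auto simp: sym_def edge_adjacent_def)
  then have sym: "(y, x) \<in> ?R\<^sup>*" if "(x, y) \<in> ?R\<^sup>*" for x y
    using that by (meson sym_rtrancl symD)
  have row: "((i, Suc (part mu i)), (i, Suc (part mu i + d))) \<in> ?R\<^sup>*"
    if "(i, Suc (part mu i + d)) \<in> ?S" for i d
    using that
  proof (induction d)
    case (Suc d)
    then have "(i, Suc (part mu i + d)) \<in> ?S" by (auto simp: mem_skew_young)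
    with Suc show ?case
      by (auto intro!: rtrancl_into_rtrancl[of _ "(i, Suc (part mu i + d))"] simp: edge_adjacent_def)
  qed simp
  have row': "((i, Suc (part mu i)), (i, j)) \<in> ?R\<^sup>*" if "(i, j) \<in> ?S" for i j
    using row[of i "j - Suc (part mu i)"] that by (simp add: mem_skew_young)
  have col: "((t, Suc (part mu t)), (t + d, Suc (part mu (t + d)))) \<in> ?R\<^sup>*" if "t + d \<le> b" for d
    using that
  proof (induction d)
    case (Suc d)
    let ?i = "t + d"
    have a: "(?i, Suc (part mu ?i)) \<in> ?S" using inside[of ?i] Suc.prems t1 by (auto simp: mem_skew_young)
    have c: "(Suc ?i, Suc (part mu ?i)) \<in> ?S"
      using step[of ?i] mu_dec[of ?i] Suc.prems t1 by (auto simp: mem_skew_young)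
    have "((?i, Suc (part mu ?i)), (Suc ?i, Suc (part mu ?i))) \<in> ?R"
      using a c by (simp add: edge_adjacent_def)
    moreover have "((t, Suc (part mu t)), (?i, Suc (part mu ?i))) \<in> ?R\<^sup>*"
      by (rule Suc.IH) (use Suc.prems in simp)
    ultimately have "((t, Suc (part mu t)), (Suc ?i, Suc (part mu ?i))) \<in> ?R\<^sup>*"
      by (rule rtrancl_into_rtrancl[rotated])
    also have "((Suc ?i, Suc (part mu ?i)), (Suc ?i, Suc (part mu (Suc ?i)))) \<in> ?R\<^sup>*"
      by (rule sym[OF row'[OF c]])
    finally show ?case by simp
  qed simp
  have all: "((t, Suc (part mu t)), x) \<in> ?R\<^sup>*" if "x \<in> ?S" for x
  proof -
    obtain i j where x: "x = (i, j)" by (cases x)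
    then have "t \<le> i" "i \<le> b" using rows[of i j] that by auto
    then have "((t, Suc (part mu t)), (i, Suc (part mu i))) \<in> ?R\<^sup>*"
      using col[of "i - t"] by simp
    from rtrancl_trans[OF this row'[of i j]] show ?thesis using that x by simp
  qed
  have conn: "edge_connected ?S"
    unfolding edge_connected_def
  proof (intro ballI)
    show "(x, y) \<in> ?R\<^sup>*" if "x \<in> ?S" "y \<in> ?S" for x y
      by (rule rtrancl_trans[OF sym[OF all[OF that(1)]] all[OF that(2)]])
  qed
  have diag: "(i + 1, j + 1) \<notin> ?S" if "(i, j) \<in> ?S" for i j
  proof
    assume n: "(i + 1, j + 1) \<in> ?S"
    have "part la (Suc i) = Suc (part mu i)"
      using step[of i] rows[OF that] rows[OF n] by simp
    then show False using n that by (simp add: mem_skew_young)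
  qed
  show "border_strip r la mu"
    unfolding border_strip_def using skew conn diag size card_skew_young[of mu la]
    by (auto simp: is_skew_def)
  have ne: "la \<noteq> mu" using top by auto
  have "(LEAST i. part la i \<noteq> part mu i) = t"
  proof (rule Least_equality)
    show "part la t \<noteq> part mu t" using top by simp
    show "t \<le> i" if "part la i \<noteq> part mu i" for i using that out by (meson not_less)
  qed
  then show "skew_top la mu = t" using ne by (simp add: skew_top_def)
  have "(GREATEST i. part la i \<noteq> part mu i) = b"
  proof (rule Greatest_equality)
    show "part la b \<noteq> part mu b" using inside[of b] t1 by simp
    show "i \<le> b" if "part la i \<noteq> part mu i" for i using that out by (meson not_less)
  qed
  then show "skew_bottom la mu = b" using ne by (simp add: skew_bottom_def)
qed


section \<open>Border strips as bead moves\<close>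

text \<open>Sends the old row of a bead to its new row: the bead moved by the strip goes from row
  \<open>b\<close> up to row \<open>t\<close>, and those in rows \<open>t\<close> to
  \<open>b - 1\<close> slip down by one.\<close>

definition strip_cycle :: "nat \<Rightarrow> nat \<Rightarrow> nat \<Rightarrow> nat" where
  "strip_cycle t b k = (if k = b then t else if t \<le> k \<and> k < b then Suc k else k)"

text \<open>The cycle is a product of \<open>b - t\<close> adjacent transpositions, one for each row
  of the strip after the first.\<close>

lemma strip_cycle_permutes:
  assumes "t \<le> b" "1 \<le> t" "b \<le> N"
  shows "strip_cycle t b permutes {1..N} \<and> sign (strip_cycle t b) = (- 1) ^ (b - t)"
  using assms
proof (induction b rule: dec_induct)
  case base
  have "strip_cycle t t = id" by (auto simp: strip_cycle_def fun_eq_iff)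
  then show ?case
    by (simp only: permutes_id sign_id diff_self_eq_0 power_0 simp_thms)
next
  case (step b)
  have eq: "strip_cycle t (Suc b) = strip_cycle t b \<circ> transpose b (Suc b)"
    using step.hyps by (auto simp: strip_cycle_def fun_eq_iff transpose_def)
  have IH: "strip_cycle t b permutes {1..N}" "sign (strip_cycle t b) = (- 1) ^ (b - t)"
    using step by auto
  have tp: "transpose b (Suc b) permutes {1..N}"
    using step by (intro permutes_swap_id) auto
  have "sign (strip_cycle t (Suc b)) = sign (strip_cycle t b) * sign (transpose b (Suc b))"
    unfolding eq using IH tp by (intro sign_compose) (auto simp: permutation_permutes)
  then show ?case
    using permutes_compose[OF tp IH(1)] IH(2) step.hyps
    by (simp add: eq sign_swap_id Suc_diff_le del: o_apply)
qed

text \<open>The beta-numbers of the partition padded by zeros to \<open>N\<close> parts: the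
  exponents in the numerator of its Schur polynomial.\<close>

definition bead :: "nat \<Rightarrow> nat list \<Rightarrow> nat \<Rightarrow> nat" where
  "bead N la j = part la j + staircase N j"

lemma bead_strict_antimono:
  "is_partition la \<Longrightarrow> 1 \<le> i \<Longrightarrow> i < j \<Longrightarrow> j \<le> N \<Longrightarrow> bead N la j < bead N la i"
  using part_antimono[of la i j] by (simp add: bead_def staircase_def)

lemma sum_bead:
  "length la \<le> N \<Longrightarrow> (\<Sum>i\<in>{1..N}. bead N la i) = sum_list la + (\<Sum>i\<in>{1..N}. staircase N i)"
  using sum_part[of la N] by (simp add: bead_def sum.distrib)

text \<open>Slipping down one row raises the part by one and lowers the staircase by one, so the
  position stays the same.\<close>

lemma strip_shape_bead:
  assumes sh: "strip_shape la mu t b" and b: "b \<le> N" and k: "k \<in> {1..N}" "k \<noteq> b"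
  shows "bead N la (strip_cycle t b k) = bead N mu k"
  using assms by (auto simp: strip_shape_def strip_cycle_def bead_def staircase_def)

text \<open>On the beads, adding an \<open>r\<close>-border strip moves one bead by \<open>r\<close>; re-sorting the beads is a
  cycle whose length is the number of rows the strip meets.\<close>

lemma border_strip_bead:
  assumes bs: "border_strip r la mu" and r: "0 < r" and len: "length la \<le> N"
    and t: "t = skew_top la mu" and b: "b = skew_bottom la mu"
  shows "1 \<le> t" "t \<le> b" "b \<le> N"
    and "\<And>k. k \<in> {1..N} \<Longrightarrow> bead N la (strip_cycle t b k) = bead N mu k + (if k = b then r else 0)"
proof -
  have sh: "strip_shape la mu t b" using border_strip_shape[OF bs r] t b by simp
  then show t1: "1 \<le> t" "t \<le> b" by (auto simp: strip_shape_def)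
  have part: "is_partition la" "is_partition mu" "par_subset mu la"
    using bs by (auto simp: border_strip_def is_skew_def)
  have len': "length mu \<le> N" using length_mono[OF part(2,1,3)] len by simp
  have "part mu t < part la t" "t < b \<longrightarrow> 0 < part la b"
    using sh by (auto simp: strip_shape_def dest!: less_imp_Suc_add)
  then have "0 < part la b" using t1 by (cases "t = b") auto
  then show bN: "b \<le> N" using part_pos_iff[OF part(1)] len by simp
  have "card (skew_young la mu) = r" using bs by (simp add: border_strip_def)
  then have "sum_list la = sum_list mu + r"
    using card_skew_young[OF part(3)] by linarith
  then have size: "(\<Sum>i\<in>{1..N}. bead N la i) = (\<Sum>i\<in>{1..N}. bead N mu i) + r"
    unfolding sum_bead[OF len] sum_bead[OF len'] by simp
  have c: "strip_cycle t b permutes {1..N}" using strip_cycle_permutes t1 bN by blast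
  have rem: "(\<Sum>i\<in>{1..N}. h i) = h b + (\<Sum>i\<in>{1..N} - {b}. h i)" for h :: "nat \<Rightarrow> nat"
    using t1 bN by (intro sum.remove) auto
  \<comment> \<open>All other beads keep their positions, so the bead of row \<open>b\<close>
    absorbs the whole increase \<open>r\<close> of the total.\<close>
  have "(\<Sum>i\<in>{1..N} - {b}. bead N la (strip_cycle t b i)) = (\<Sum>i\<in>{1..N} - {b}. bead N mu i)"
    using strip_shape_bead[OF sh bN] by (intro sum.cong) auto
  moreover have "(\<Sum>i\<in>{1..N}. bead N la i) = (\<Sum>i\<in>{1..N}. bead N la (strip_cycle t b i))"
    using sum.permute[OF c, of "bead N la"] by (simp add: comp_def)
  ultimately have "bead N la (strip_cycle t b b) = bead N mu b + r"
    using size rem[of "\<lambda>i. bead N la (strip_cycle t b i)"] rem[of "bead N mu"] by linarith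
  then show "bead N la (strip_cycle t b k) = bead N mu k + (if k = b then r else 0)"
    if "k \<in> {1..N}" for k
    using strip_shape_bead[OF sh bN that] by auto
qed

text \<open>Lists representing partitions hold positive parts only. A vanishing last value is
  dropped by induction; if the last value is positive, all of them are.\<close>

lemma partition_of_antimono:
  assumes "\<And>i. 1 \<le> i \<Longrightarrow> i < N \<Longrightarrow> f (Suc i) \<le> (f i :: nat)"
  shows "\<exists>la. is_partition la \<and> length la \<le> N \<and> (\<forall>i\<in>{1..N}. part la i = f i)"
  using assms
proof (induction N)
  case 0
  show ?case by (rule exI[of _ "[]"]) (simp add: is_partition_def)
next
  case (Suc N)
  show ?case
  proof (cases "f (Suc N) = 0")
    case True
    obtain la where la: "is_partition la" "length la \<le> N" "\<forall>i\<in>{1..N}. part la i = f i"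
      using Suc by auto
    then show ?thesis using True
      by (intro exI[of _ la]) (simp add: atLeastAtMostSuc_conv part_gt_length del: One_nat_def)
  next
    case False
    have anti: "f j \<le> f i" if "i \<le> j" "1 \<le> i" "j \<le> Suc N" for i j
      using that
    proof (induction j rule: dec_induct)
      case (step j)
      then have "f (Suc j) \<le> f j" by (intro Suc.prems) auto
      also have "\<dots> \<le> f i" using step by simp
      finally show ?case .
    qed simp
    let ?la = "map f [1..<Suc (Suc N)]"
    have "is_partition ?la"
      unfolding is_partition_def
    proof
      show "sorted_wrt (\<ge>) ?la"
        by (auto simp: sorted_wrt_iff_nth_less simp del: upt_Suc intro!: anti)
      show "\<forall>p\<in>set ?la. 0 < p"
      proof
        fix p assume "p \<in> set ?la"
        then obtain i where "p = f i" "1 \<le> i" "i \<le> Suc N" by (auto simp del: upt_Suc)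
        then show "0 < p" using anti[of i "Suc N"] False by simp
      qed
    qed
    then show ?thesis
      by (intro exI[of _ ?la]) (auto simp: part_def simp del: upt_Suc)
  qed
qed

text \<open>The moved bead is inserted in the first row \<open>t\<close> whose bead lies below the
  target. Since the target is free, all earlier beads lie strictly beyond it, which keeps the new
  parts non-increasing.\<close>

lemma border_strip_of_bead_move:
  assumes mu: "is_partition mu" "length mu \<le> N" and r: "0 < r" and b: "b \<in> {1..N}"
    and free: "bead N mu b + r \<notin> bead N mu ` {1..N}"
  obtains la where "border_strip r la mu" "length la \<le> N" "skew_bottom la mu = b"
proof -
  let ?x = "bead N mu b + r"
  define t where "t = (LEAST k. 1 \<le> k \<and> bead N mu k < ?x)"
  have tP: "1 \<le> t \<and> bead N mu t < ?x"
    unfolding t_def by (rule LeastI[of _ b]) (use b r in auto)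
  have tb: "t \<le> b"
    unfolding t_def by (rule Least_le) (use b r in auto)
  have before: "?x < bead N mu k" if "1 \<le> k" "k < t" for k
  proof -
    have "?x \<le> bead N mu k"
      using not_less_Least[of k "\<lambda>k. 1 \<le> k \<and> bead N mu k < ?x"] that unfolding t_def by auto
    moreover have "bead N mu k \<in> bead N mu ` {1..N}" using that tb b by auto
    ultimately show ?thesis using free by (metis order_le_less)
  qed
  \<comment> \<open>Row \<open>t\<close> holds the target position with the staircase removed; the
    rows after it, down to \<open>b\<close>, receive the beads that slip down.\<close>
  define f where "f k = (if k = t then ?x - (N - t)
      else if t < k \<and> k \<le> b then Suc (part mu (k - 1)) else part mu k)" for k
  have tN: "t \<le> N" "b \<le> N" using tb b by auto
  have ft: "f t + (N - t) = ?x" using tP by (simp add: f_def bead_def staircase_def)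
  then have ft': "part mu t < f t" using tP by (simp add: bead_def staircase_def)
  have dec: "part mu (Suc i) \<le> part mu i" if "1 \<le> i" for i
    using part_antimono[OF mu(1), of i "Suc i"] that by simp
  have "f (Suc i) \<le> f i" if i: "1 \<le> i" "i < N" for i
  proof -
    consider "Suc i < t" | "Suc i = t" | "i = t" | "t < i" by linarith
    then show ?thesis
    proof cases
      case 2
      then have "?x < part mu i + (N - i)" using before[of i] i by (simp add: bead_def staircase_def)
      then show ?thesis using 2 ft tN tb by (simp add: f_def)
    next
      case 3
      then show ?thesis using ft' dec[of i] i by (simp add: f_def)
    next
      case 4
      then have "part mu i \<le> part mu (i - 1)" using dec[of "i - 1"] tP by (cases i) auto
      then show ?thesis using 4 dec[of i] tP by (auto simp: f_def)
    qed (use dec i tb in \<open>simp add: f_def\<close>)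
  qed
  then obtain la where la: "is_partition la" "length la \<le> N" "\<forall>i\<in>{1..N}. part la i = f i"
    using partition_of_antimono[of N f] by blast
  have sh: "strip_shape la mu t b"
    unfolding strip_shape_def
  proof (intro conjI allI impI)
    show "1 \<le> t" "t \<le> b" using tP tb by auto
    show "part mu t < part la t" using ft' la tN tP by simp
    show "part la i = part mu i" if "i < t \<or> b < i" for i
    proof (cases "i \<in> {1..N}")
      case True
      then show ?thesis using la that tb by (auto simp: f_def)
    next
      case False
      then show ?thesis using la(2) mu(2) by (cases i) (auto simp: part_gt_length)
    qed
    show "part la (Suc i) = Suc (part mu i)" if "t \<le> i \<and> i < b" for i
      using la that tN by (auto simp: f_def)
  qed
  have c: "strip_cycle t b permutes {1..N}" using strip_cycle_permutes tP tb tN by blast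
  have rem: "(\<Sum>i\<in>{1..N}. h i) = h b + (\<Sum>i\<in>{1..N} - {b}. h i)" for h :: "nat \<Rightarrow> nat"
    using b by (intro sum.remove) auto
  have "bead N la (strip_cycle t b b) = ?x"
    using la tN tP ft by (simp add: strip_cycle_def bead_def staircase_def)
  moreover have "(\<Sum>i\<in>{1..N} - {b}. bead N la (strip_cycle t b i)) = (\<Sum>i\<in>{1..N} - {b}. bead N mu i)"
    using strip_shape_bead[OF sh tN(2)] by (intro sum.cong) auto
  moreover have "(\<Sum>i\<in>{1..N}. bead N la i) = (\<Sum>i\<in>{1..N}. bead N la (strip_cycle t b i))"
    using sum.permute[OF c, of "bead N la"] by (simp add: comp_def)
  ultimately have "(\<Sum>i\<in>{1..N}. bead N la i) = (\<Sum>i\<in>{1..N}. bead N mu i) + r"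
    using rem[of "\<lambda>i. bead N la (strip_cycle t b i)"] rem[of "bead N mu"] by linarith
  then have "sum_list la = sum_list mu + r" unfolding sum_bead[OF la(2)] sum_bead[OF mu(2)] by simp
  then show thesis using that shape_border_strip[OF la(1) mu(1) sh] la(2) by blast
qed


section \<open>Chains of border strips\<close>

lemma strip_chain_singleton: "is_partition mu \<Longrightarrow> strip_chain r mu mu [mu]"
  by (simp add: strip_chain_def)

lemma strip_chain_nth:
  "strip_chain r la mu gs \<Longrightarrow> Suc i < length gs \<Longrightarrow> border_strip r (gs ! Suc i) (gs ! i)"
  by (simp add: strip_chain_def)

text \<open>Chains are built and taken apart at their upper end \<open>la\<close>, where only one
  strip and one comparison of tops are new.\<close>

lemma strip_chain_snoc:
  assumes "gs \<noteq> []"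
  shows "strip_chain r la mu (gs @ [la]) \<longleftrightarrow>
    strip_chain r (last gs) mu gs \<and> is_partition la \<and> border_strip r la (last gs) \<and>
    (1 < length gs \<longrightarrow> skew_top la (last gs) \<le> skew_top (last gs) (gs ! (length gs - 2)))"
proof -
  obtain n where n: "length gs = Suc n" using assms by (cases gs) auto
  have last: "last gs = gs ! n" using assms n by (simp add: last_conv_nth)
  have strips: "(\<forall>i. i + 1 < length (gs @ [la]) \<longrightarrow> border_strip r ((gs @ [la]) ! (i + 1)) ((gs @ [la]) ! i)) \<longleftrightarrow>
      (\<forall>i. i + 1 < length gs \<longrightarrow> border_strip r (gs ! (i + 1)) (gs ! i)) \<and> border_strip r la (gs ! n)"
    by (auto simp: n nth_append less_Suc_eq)
  have tops: "(\<forall>i. i + 2 < length (gs @ [la]) \<longrightarrow>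
        skew_top ((gs @ [la]) ! (i + 2)) ((gs @ [la]) ! (i + 1)) \<le> skew_top ((gs @ [la]) ! (i + 1)) ((gs @ [la]) ! i)) \<longleftrightarrow>
      (\<forall>i. i + 2 < length gs \<longrightarrow>
        skew_top (gs ! (i + 2)) (gs ! (i + 1)) \<le> skew_top (gs ! (i + 1)) (gs ! i)) \<and>
      (0 < n \<longrightarrow> skew_top la (gs ! n) \<le> skew_top (gs ! n) (gs ! (n - 1)))"
    (is "(\<forall>i. ?P i) \<longleftrightarrow> (\<forall>i. ?Q i) \<and> ?L")
  proof -
    have P: "?P i \<longleftrightarrow> ?Q i" if "i + 1 \<noteq> n" for i
      using that by (auto simp: n nth_append)
    have L: "?P i \<longleftrightarrow> ?L" and Q: "?Q i" if "i + 1 = n" for i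
      using that by (auto simp: n nth_append)
    show ?thesis
    proof (cases n)
      case 0
      then have "i + 1 \<noteq> n" for i by simp
      then have "?P i \<longleftrightarrow> ?Q i" for i by (rule P)
      moreover have ?L using 0 by simp
      ultimately show ?thesis by blast
    next
      case (Suc k)
      then have k: "k + 1 = n" by simp
      have "?P i \<longleftrightarrow> ?Q i \<and> (i = k \<longrightarrow> ?L)" for i
      proof (cases "i = k")
        case True
        then show ?thesis using L[OF k] Q[OF k] by blast
      next
        case False
        then have "i + 1 \<noteq> n" using k by simp
        then show ?thesis using False by (simp only: P simp_thms)
      qed
      then show ?thesis by blast
    qed
  qed
  have l: "last gs = gs ! n" "gs ! (length gs - 2) = gs ! (n - 1)" "1 < length gs \<longleftrightarrow> 0 < n"
    using last by (auto simp: n numeral_2_eq_2)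
  have hd: "hd (gs @ [la]) = hd gs" using assms by simp
  show ?thesis
    unfolding strip_chain_def strips tops l hd using assms by auto
qed

text \<open>A chain of border strips from \<open>mu\<close> to \<open>la\<close> moves labelled beads to the positions \<open>g\<close>, and
  \<open>p\<close> sorts them. The top of the last strip is the row of the largest bead that has moved at all,
  so along a chain the target positions of the moves increase.\<close>

definition chain_beads ::
  "nat \<Rightarrow> nat \<Rightarrow> nat list \<Rightarrow> nat \<Rightarrow> nat list \<Rightarrow> nat list list \<Rightarrow> (nat \<Rightarrow> nat) \<Rightarrow> (nat \<Rightarrow> nat) \<Rightarrow> bool" where
  "chain_beads r N mu d la gs g p \<longleftrightarrow>
     strip_chain r la mu gs \<and> length gs = Suc d \<and> length la \<le> N \<and>
     g \<in> bead_moves r N (bead N mu) d \<and> noncrossing r N (bead N mu) g \<and>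
     p permutes {1..N} \<and> (\<forall>i\<in>{1..N}. g i = bead N la (p i)) \<and>
     sign p = (\<Prod>i = 1..d. strip_sgn (gs ! i) (gs ! (i - 1))) \<and>
     (0 < d \<longrightarrow>
       (\<exists>i\<in>{1..N}. g i \<noteq> bead N mu i \<and> g i = bead N la (skew_top la (gs ! (d - 1)))) \<and>
       (\<forall>i\<in>{1..N}. g i \<noteq> bead N mu i \<longrightarrow> g i \<le> bead N la (skew_top la (gs ! (d - 1)))))"

section \<open>Chains and noncrossing configurations\<close>

lemma add_le_of_mod_eq:
  fixes x y r :: nat
  assumes "x < y" "x mod r = y mod r"
  shows "x + r \<le> y"
proof -
  have "r dvd y - x" using mod_eq_dvd_iff_nat[of x y r] assms by simp
  then have "r \<le> y - x" using assms by (intro dvd_imp_le) auto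
  then show ?thesis using assms by simp
qed

lemma chain_beads_0:
  assumes "is_partition mu" "length mu \<le> N"
  shows "chain_beads r N mu 0 mu [mu] (\<lambda>i. if i \<in> {1..N} then bead N mu i else 0) id"
  using assms
  by (simp add: chain_beads_def strip_chain_singleton bead_moves_def noncrossing_def permutes_id del: id_apply)
    simp

lemma bead_inj: "is_partition la \<Longrightarrow> inj_on (bead N la) {1..N}"
  by (rule linorder_inj_onI) (auto dest: bead_strict_antimono)

lemma strip_chain_partition:
  "strip_chain r la mu gs \<Longrightarrow> is_partition la"
  unfolding strip_chain_def by (metis last_in_set)

text \<open>One more strip moves bead \<open>i\<close> by \<open>r\<close>. The assumption that the
  target lies beyond all beads already moved yields both invariants: the moves stay noncrossing, and
  the tops stay non-increasing.\<close>

lemma chain_beads_step: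
  assumes c: "chain_beads r N mu d la gs g p" and r: "0 < r" and mu: "is_partition mu"
    and bs: "border_strip r la' la" and len: "length la' \<le> N"
    and i: "i \<in> {1..N}" "p i = skew_bottom la' la"
    and last: "\<And>j. j \<in> {1..N} \<Longrightarrow> g j \<noteq> bead N mu j \<Longrightarrow> g j < g i + r"
  shows "chain_beads r N mu (Suc d) la' (gs @ [la']) (g(i := g i + r))
    (strip_cycle (skew_top la' la) (skew_bottom la' la) \<circ> p)"
proof -
  let ?B = "bead N mu" and ?t = "skew_top la' la" and ?b = "skew_bottom la' la"
  let ?g = "g(i := g i + r)" and ?p = "strip_cycle ?t ?b \<circ> p"
  have chain: "strip_chain r la mu gs" and lgs: "length gs = Suc d"
    and g: "g \<in> bead_moves r N ?B d" and nc: "noncrossing r N ?B g"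
    and p: "p permutes {1..N}" and gp: "\<And>j. j \<in> {1..N} \<Longrightarrow> g j = bead N la (p j)"
    and sgn: "sign p = (\<Prod>i = 1..d. strip_sgn (gs ! i) (gs ! (i - 1)))"
    and top: "0 < d \<Longrightarrow> \<exists>j\<in>{1..N}. g j \<noteq> ?B j \<and> g j = bead N la (skew_top la (gs ! (d - 1)))"
    using c unfolding chain_beads_def by blast+
  have gs: "gs \<noteq> []" using lgs by auto
  have lastgs: "last gs = la" using chain by (simp add: strip_chain_def)
  then have gsd: "gs ! d = la" using gs lgs by (simp add: last_conv_nth)
  have part: "is_partition la'" "is_partition la" using bs by (auto simp: border_strip_def is_skew_def)
  note B = border_strip_bead[OF bs r len refl refl]
  have cyc: "strip_cycle ?t ?b permutes {1..N}" "sign (strip_cycle ?t ?b) = (- 1) ^ (?b - ?t)"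
    using strip_cycle_permutes[OF B(2,1,3)] by auto
  have p': "?p permutes {1..N}" by (rule permutes_compose[OF p cyc(1)])
  have pj: "p j = ?b \<longleftrightarrow> j = i" for j
    using i(2) permutes_inj[OF p] by (metis injD)
  have gp': "?g j = bead N la' (?p j)" if "j \<in> {1..N}" for j
    using B(4)[of "p j"] gp[OF that] that permutes_in_image[OF p, of j] pj[of j] by auto
  have inj': "inj_on ?g {1..N}"
  proof (rule inj_onI)
    fix j k assume jk: "j \<in> {1..N}" "k \<in> {1..N}" "?g j = ?g k"
    then have "bead N la' (?p j) = bead N la' (?p k)" using gp' by metis
    then have "?p j = ?p k"
      using bead_inj[OF part(1), of N] jk permutes_in_image[OF p'] by (metis inj_onD)
    then show "j = k" using permutes_inj[OF p'] by (metis injD)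
  qed
  have free: "g j \<noteq> g i + r" if "j \<in> {1..N}" for j
    using inj_onD[OF inj', of j i] that i(1) r by (cases "j = i") auto
  have gB: "?B j \<le> g j" "g j mod r = ?B j mod r" if "j \<in> {1..N}" for j
    using g that unfolding bead_moves_def by blast+
  have moves: "?g \<in> bead_moves r N ?B (Suc d)"
    unfolding bead_moves_def
  proof (intro CollectI conjI allI impI ballI)
    show "?g j = 0" if "j \<notin> {1..N}" for j
      using that i(1) g by (auto simp: bead_moves_def)
    show "?B j \<le> ?g j" if "j \<in> {1..N}" for j using gB[OF that] by auto
    show "?g j mod r = ?B j mod r" if "j \<in> {1..N}" for j using gB[OF that] by auto
    have "sum ?g {1..N} = ?g i + sum ?g ({1..N} - {i})" "sum g {1..N} = g i + sum g ({1..N} - {i})"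
      using i(1) by (simp_all only: sum.remove[OF finite_atLeastAtMost])
    moreover have "sum ?g ({1..N} - {i}) = sum g ({1..N} - {i})" by (rule sum.cong) auto
    moreover have "sum g {1..N} = sum ?B {1..N} + r * d" using g unfolding bead_moves_def by blast
    ultimately show "sum ?g {1..N} = sum ?B {1..N} + r * Suc d" by simp
  qed
  have nc': "noncrossing r N ?B ?g"
    unfolding noncrossing_def
  proof (intro ballI impI)
    fix k j assume kj: "k \<in> {1..N}" "j \<in> {1..N}" and lt: "?B j < ?B k \<and> ?B j mod r = ?B k mod r"
    then have less: "g j < ?B k" using nc unfolding noncrossing_def by blast
    show "?g j < ?B k"
    proof (cases "j = i")
      case True
      then have le: "g i + r \<le> ?B k" using less lt gB[OF kj(2)] by (intro add_le_of_mod_eq) auto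
      \<comment> \<open>At equality bead \<open>k\<close> has either not moved, so that the target
        is occupied, or moved beyond its start, against \<open>last\<close>.\<close>
      have "g i + r \<noteq> ?B k" using last[OF kj(1)] free[OF kj(1)] gB[OF kj(1)] by auto
      then show ?thesis using le True by simp
    qed (use less in simp)
  qed
  have perm: "permutation p" "permutation (strip_cycle ?t ?b)"
    using p cyc by (auto simp: permutation_permutes)
  have sgn': "sign ?p = (\<Prod>k = 1..Suc d. strip_sgn ((gs @ [la']) ! k) ((gs @ [la']) ! (k - 1)))"
  proof -
    have "(\<Prod>k = 1..d. strip_sgn ((gs @ [la']) ! k) ((gs @ [la']) ! (k - 1))) = sign p"
      unfolding sgn by (rule prod.cong) (auto simp: nth_append lgs)
    then show ?thesis
      using sign_compose[OF perm(2,1)] cyc(2) by (simp add: nth_append lgs gsd strip_sgn_def)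
  qed
  have q: "bead N la' ?t = g i + r"
    using gp'[OF i(1)] i(2) by (simp add: strip_cycle_def)
  \<comment> \<open>If the new strip started below row \<open>?s\<close>, the moved bead in that row
    would keep its position and lie beyond the new target.\<close>
  have tops: "?t \<le> skew_top la (gs ! (d - 1))" if d: "0 < d"
  proof (rule ccontr)
    let ?s = "skew_top la (gs ! (d - 1))"
    assume "\<not> ?t \<le> ?s"
    then have st: "?s < ?t" by simp
    obtain j where j: "j \<in> {1..N}" "g j \<noteq> ?B j" "g j = bead N la ?s" using top[OF d] by blast
    have "border_strip r (gs ! Suc (d - 1)) (gs ! (d - 1))"
      by (rule strip_chain_nth[OF chain]) (use d lgs in simp)
    then have "strip_shape la (gs ! (d - 1)) ?s (skew_bottom la (gs ! (d - 1)))"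
      using border_strip_shape r d gsd by simp
    then have s1: "1 \<le> ?s" by (simp add: strip_shape_def)
    have "bead N la' ?s = bead N la ?s"
      using border_strip_shape[OF bs r] st by (simp add: strip_shape_def bead_def)
    moreover have "bead N la' ?t < bead N la' ?s"
      using bead_strict_antimono[OF part(1) s1 st] B by simp
    ultimately show False using last[OF j(1,2)] j(3) q by simp
  qed
  have chain': "strip_chain r la' mu (gs @ [la'])"
    unfolding strip_chain_snoc[OF gs] lastgs
    using chain part bs tops by (auto simp: lgs numeral_2_eq_2)
  have moved: "?g i \<noteq> ?B i" using gB[OF i(1)] r by simp
  have prev: "(gs @ [la']) ! (Suc d - 1) = la" using gsd lgs by (simp add: nth_append)
  have ex: "\<exists>k\<in>{1..N}. ?g k \<noteq> ?B k \<and> ?g k = bead N la' ?t"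
    by (rule bexI[OF _ i(1)]) (use moved q in simp)
  have max: "?g k \<le> bead N la' ?t" if "k \<in> {1..N}" "?g k \<noteq> ?B k" for k
    using last[OF that(1)] that(2) q by (cases "k = i") auto
  have "length (gs @ [la']) = Suc (Suc d)" using lgs by simp
  then show ?thesis
    unfolding chain_beads_def prev
    by (intro conjI impI ballI chain' len moves nc' p' gp' sgn' ex max)
qed

text \<open>Beads meeting at one position belong to the same residue class, and the smaller one
  would have reached the start of the larger.\<close>

lemma noncrossing_inj:
  assumes "is_partition mu" "g \<in> bead_moves r N (bead N mu) d" "noncrossing r N (bead N mu) g"
  shows "inj_on g {1..N}"
proof (rule inj_onI)
  fix i j assume ij: "i \<in> {1..N}" "j \<in> {1..N}" "g i = g j"
  let ?B = "bead N mu"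
  have gB: "?B j \<le> g j" "g j mod r = ?B j mod r" if "j \<in> {1..N}" for j
    using assms(2) that unfolding bead_moves_def by blast+
  have md: "?B i mod r = ?B j mod r" using gB[OF ij(1)] gB[OF ij(2)] ij(3) by simp
  have "\<not> ?B i < ?B j" "\<not> ?B j < ?B i"
    using assms(3) ij md gB[OF ij(1)] gB[OF ij(2)] unfolding noncrossing_def by fastforce+
  then show "i = j" using inj_onD[OF bead_inj[OF assms(1)], of N i j] ij by simp
qed

text \<open>Let bead \<open>i\<close> under \<open>g\<close> and bead \<open>j\<close> under
  \<open>h\<close> end at the same position. If their starts differed, the bead with the smaller
  start would have reached the larger start.\<close>

lemma noncrossing_eqI:
  assumes mu: "is_partition mu"
    and g: "g \<in> bead_moves r N (bead N mu) d" "noncrossing r N (bead N mu) g"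
    and h: "h \<in> bead_moves r N (bead N mu) d" "noncrossing r N (bead N mu) h"
    and eq: "g ` {1..N} = h ` {1..N}"
  shows "g = h"
proof
  fix i
  let ?B = "bead N mu"
  have B: "?B j \<le> g j" "g j mod r = ?B j mod r" "?B j \<le> h j" "h j mod r = ?B j mod r"
    if "j \<in> {1..N}" for j
    using g h that unfolding bead_moves_def by blast+
  show "g i = h i"
  proof (cases "i \<in> {1..N}")
    case True
    then obtain j where j: "j \<in> {1..N}" "g i = h j" using eq by (metis image_iff)
    have md: "?B i mod r = ?B j mod r" using B[OF True] B[OF j(1)] j(2) by simp
    have "\<not> ?B i < ?B j"
      using g(2) True j md B[OF j(1)] unfolding noncrossing_def by fastforce
    moreover have "\<not> ?B j < ?B i"
      using h(2) True j md B[OF True] unfolding noncrossing_def by fastforce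
    ultimately have "i = j" using inj_onD[OF bead_inj[OF mu], of N i j] True j by simp
    then show ?thesis using j by simp
  next
    case False
    then show ?thesis using g(1) h(1) unfolding bead_moves_def by auto
  qed
qed

text \<open>Induction by undoing the last step: among the beads that have moved, the one with the
  largest final position goes back by \<open>r\<close>.\<close>

lemma noncrossing_chain:
  assumes mu: "is_partition mu" "length mu \<le> N" and r: "0 < r"
  shows "g \<in> bead_moves r N (bead N mu) d \<Longrightarrow> noncrossing r N (bead N mu) g \<Longrightarrow>
    \<exists>la gs p. chain_beads r N mu d la gs g p"
proof (induction d arbitrary: g)
  case 0
  let ?B = "bead N mu"
  have B: "?B j \<le> g j" if "j \<in> {1..N}" for j using 0 that unfolding bead_moves_def by blast
  have "sum g {1..N} = sum ?B {1..N}" using 0 unfolding bead_moves_def by auto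
  then have "g j = ?B j" if "j \<in> {1..N}" for j
    using sum_mono_inv[of ?B "{1..N}" g j] B that by simp
  then have "g = (\<lambda>i. if i \<in> {1..N} then ?B i else 0)"
    using 0 unfolding bead_moves_def by fastforce
  then show ?case using chain_beads_0[OF mu] by blast
next
  case (Suc d)
  let ?B = "bead N mu"
  let ?M = "{j \<in> {1..N}. g j \<noteq> ?B j}"
  have B: "?B j \<le> g j" "g j mod r = ?B j mod r" if "j \<in> {1..N}" for j
    using Suc.prems that unfolding bead_moves_def by blast+
  have sumg: "sum g {1..N} = sum ?B {1..N} + r * Suc d"
    using Suc.prems unfolding bead_moves_def by blast
  have "?M \<noteq> {}"
  proof
    assume "?M = {}"
    then have "sum g {1..N} = sum ?B {1..N}" by (intro sum.cong) auto
    then show False using sumg r by simp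
  qed
  then have "Max (g ` ?M) \<in> g ` ?M" by (intro Max_in) auto
  then obtain i where i: "i \<in> {1..N}" "g i \<noteq> ?B i" "g i = Max (g ` ?M)" by auto
  have max: "g j \<le> g i" if "j \<in> {1..N}" "g j \<noteq> ?B j" for j
    unfolding i(3) using that by (intro Max_ge) auto
  have inj: "inj_on g {1..N}" by (rule noncrossing_inj[OF mu(1) Suc.prems])
  have step: "?B i + r \<le> g i"
    using B[OF i(1)] i(2) by (intro add_le_of_mod_eq) auto
  define h where "h = g(i := g i - r)"
  have gh: "g = h(i := h i + r)" using step by (simp add: h_def)
  have h: "h \<in> bead_moves r N ?B d"
    unfolding bead_moves_def
  proof (intro CollectI conjI allI impI ballI)
    show "h j = 0" if "j \<notin> {1..N}" for j
      using that i(1) Suc.prems(1) by (auto simp: bead_moves_def h_def)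
    show "?B j \<le> h j" if "j \<in> {1..N}" for j using B[OF that] step by (auto simp: h_def)
    have "r \<le> g i" using step by simp
    then have "(g i - r) mod r = g i mod r" by (rule le_mod_geq[symmetric])
    then show "h j mod r = ?B j mod r" if "j \<in> {1..N}" for j using B[OF that] by (auto simp: h_def)
    have "sum h {1..N} = h i + sum h ({1..N} - {i})" "sum g {1..N} = g i + sum g ({1..N} - {i})"
      using i(1) by (simp_all only: sum.remove[OF finite_atLeastAtMost])
    moreover have "sum h ({1..N} - {i}) = sum g ({1..N} - {i})" by (rule sum.cong) (auto simp: h_def)
    moreover have "g i = h i + r" using step by (simp add: h_def)
    ultimately show "sum h {1..N} = sum ?B {1..N} + r * d" using sumg by simp
  qed
  have "h j \<le> g j" for j by (simp add: h_def)
  then have nc: "noncrossing r N ?B h"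
    using Suc.prems(2) unfolding noncrossing_def by (meson le_less_trans)
  obtain la gs p where c: "chain_beads r N mu d la gs h p" using Suc.IH[OF h nc] by blast
  have la: "is_partition la" "length la \<le> N" and p: "p permutes {1..N}"
    and hp: "\<And>j. j \<in> {1..N} \<Longrightarrow> h j = bead N la (p j)"
    using c strip_chain_partition unfolding chain_beads_def by blast+
  have pi: "p i \<in> {1..N}" using permutes_in_image[OF p] i(1) by blast
  \<comment> \<open>An occupied target would give two beads the same position in
    \<open>g\<close>.\<close>
  have "bead N la (p i) + r \<notin> bead N la ` {1..N}"
  proof
    assume "bead N la (p i) + r \<in> bead N la ` {1..N}"
    then obtain k where k: "k \<in> {1..N}" "bead N la (p i) + r = bead N la k" by blast
    then obtain j where j: "j \<in> {1..N}" "k = p j" using permutes_image[OF p] by blast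
    have "g i = h j" using k(2) hp[OF i(1)] hp[OF j(1)] j(2) fun_cong[OF gh, of i] by simp
    then show False
      using inj_onD[OF inj, of i j] i(1) j(1) step r by (cases "j = i") (auto simp: h_def)
  qed
  then obtain la' where la': "border_strip r la' la" "length la' \<le> N" "skew_bottom la' la = p i"
    using border_strip_of_bead_move[OF la r pi] by metis
  have "h j < h i + r" if "j \<in> {1..N}" "h j \<noteq> ?B j" for j
  proof (cases "j = i")
    case False
    then have "g j \<le> g i" "g j \<noteq> g i"
      using max[of j] that inj_onD[OF inj, of j i] i(1) by (auto simp: h_def)
    then show ?thesis using False step by (simp add: h_def)
  qed (use r in simp)
  from chain_beads_step[OF c r mu(1) la'(1,2) i(1) la'(3)[symmetric] this]
  show ?case unfolding gh[symmetric] by blast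
qed

text \<open>Induction along the chain; non-increasing tops supply the assumption of
  \<open>chain_beads_step\<close> that the new target lies beyond all beads already moved.\<close>

lemma chain_noncrossing:
  assumes mu: "is_partition mu" and r: "0 < r"
  shows "strip_chain r la mu gs \<Longrightarrow> length gs = Suc d \<Longrightarrow> length la \<le> N \<Longrightarrow>
    \<exists>g p. chain_beads r N mu d la gs g p"
proof (induction d arbitrary: la gs)
  case 0
  then obtain x where "gs = [x]" by (cases gs) auto
  then have "gs = [mu]" "la = mu" using 0(1) by (auto simp: strip_chain_def)
  then show ?case using chain_beads_0[OF mu, of N r] 0(3) by blast
next
  case (Suc d)
  obtain hs x where gs: "gs = hs @ [x]" using Suc.prems(2) by (cases gs rule: rev_cases) auto
  have x: "x = la" using Suc.prems(1) gs by (simp add: strip_chain_def)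
  have hs: "length hs = Suc d" "hs \<noteq> []" using Suc.prems(2) gs by auto
  let ?ka = "last hs"
  have chain: "strip_chain r ?ka mu hs" and bs: "border_strip r la ?ka"
    and tops: "1 < length hs \<longrightarrow> skew_top la ?ka \<le> skew_top ?ka (hs ! (length hs - 2))"
    using Suc.prems(1) unfolding gs x strip_chain_snoc[OF hs(2)] by auto
  have part: "is_partition la" "is_partition ?ka" "par_subset ?ka la"
    using bs by (auto simp: border_strip_def is_skew_def)
  have len: "length ?ka \<le> N" using length_mono[OF part(2,1,3)] Suc.prems(3) by simp
  obtain g p where c: "chain_beads r N mu d ?ka hs g p"
    using Suc.IH[OF chain hs(1) len] by blast
  note B = border_strip_bead[OF bs r Suc.prems(3) refl refl]
  have p: "p permutes {1..N}" and gp: "\<And>j. j \<in> {1..N} \<Longrightarrow> g j = bead N ?ka (p j)"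
    using c unfolding chain_beads_def by auto
  have "skew_bottom la ?ka \<in> p ` {1..N}" using permutes_image[OF p] B by auto
  then obtain i where i: "i \<in> {1..N}" "p i = skew_bottom la ?ka" by (metis image_iff)
  have q: "bead N la (skew_top la ?ka) = g i + r"
    using B(4)[of "skew_bottom la ?ka"] B(1-3) gp[OF i(1)] i(2) by (simp add: strip_cycle_def)
  have "g j < g i + r" if j: "j \<in> {1..N}" "g j \<noteq> bead N mu j" for j
  proof (cases "d = 0")
    case True
    then have eq: "sum g {1..N} = sum (bead N mu) {1..N}" and le: "\<And>k. k \<in> {1..N} \<Longrightarrow> bead N mu k \<le> g k"
      using c unfolding chain_beads_def bead_moves_def by auto
    have "g j = bead N mu j"
      using sum_mono_inv[of "bead N mu" "{1..N}" g j] eq le j(1) by simp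
    then show ?thesis using j by simp
  next
    case False
    \<comment> \<open>Moved beads are at most the bead in the previous top row \<open>?s\<close>. As
      \<open>?t \<le> ?s\<close>, that bead is at most the one in row \<open>?t\<close>, and the new
      strip raises the entry of row \<open>?t\<close> to the target.\<close>
    let ?t = "skew_top la ?ka" and ?s = "skew_top ?ka (hs ! (d - 1))"
    have "length hs - 2 = d - 1" using hs(1) by simp
    then have ts: "?t \<le> ?s" using tops hs(1) False by simp
    have "hs ! Suc (d - 1) = ?ka" using hs False by (simp add: last_conv_nth)
    moreover have "border_strip r (hs ! Suc (d - 1)) (hs ! (d - 1))"
      by (rule strip_chain_nth[OF chain]) (use False hs(1) in simp)
    ultimately have "?s \<le> N"
      using border_strip_bead(2,3)[of r ?ka "hs ! (d - 1)" N ?s, OF _ r len refl refl] by simp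
    then have "bead N ?ka ?s \<le> bead N ?ka ?t"
      using bead_strict_antimono[OF part(2) B(1), of ?s N] ts by (cases "?t = ?s") auto
    moreover have "part ?ka ?t < part la ?t"
      using border_strip_shape[OF bs r] by (simp add: strip_shape_def)
    then have "bead N ?ka ?t < bead N la ?t" by (simp add: bead_def)
    moreover have "g j \<le> bead N ?ka ?s"
      using c False j unfolding chain_beads_def by auto
    ultimately show ?thesis using q by simp
  qed
  from chain_beads_step[OF c r mu bs Suc.prems(3) i this]
  show ?case unfolding gs x by blast
qed


section \<open>The plethystic Murnaghan--Nakayama rule\<close>

text \<open>Beads decrease strictly with the row, so their set determines them: by strong induction
  on the row, each is the largest one left.\<close>

lemma bead_image_eqD:
  assumes la: "is_partition la" "length la \<le> N" and ka: "is_partition ka" "length ka \<le> N"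
    and eq: "bead N la ` {1..N} = bead N ka ` {1..N}"
  shows "la = ka"
proof (rule partition_eqI[OF la(1) ka(1)])
  have "1 \<le> i \<longrightarrow> i \<le> N \<longrightarrow> bead N la i = bead N ka i" for i
  proof (induction i rule: less_induct)
    case (less i)
    show ?case
    proof (intro impI)
      assume i: "1 \<le> i" "i \<le> N"
      have le: "bead N ta i \<le> bead N ha i"
        if ha: "is_partition ha" and ta: "is_partition ta" and im: "bead N ta ` {1..N} = bead N ha ` {1..N}"
          and IH: "\<And>k. k < i \<Longrightarrow> 1 \<le> k \<Longrightarrow> bead N ta k = bead N ha k" for ha ta
      proof -
        have "bead N ta i \<in> bead N ha ` {1..N}" using i im by auto
        then obtain k where k: "1 \<le> k" "k \<le> N" "bead N ta i = bead N ha k" by auto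
        have "\<not> k < i"
          using IH[of k] k bead_strict_antimono[OF ta k(1), of i N] i by auto
        then show ?thesis using k bead_strict_antimono[OF ha i(1), of k N] by (cases "k = i") auto
      qed
      show "bead N la i = bead N ka i"
        using le[OF ka(1) la(1) eq] le[OF la(1) ka(1) eq[symmetric]] less i by (intro antisym) auto
    qed
  qed
  then have "part la i = part ka i" if "1 \<le> i" "i \<le> N" for i
    using that by (force simp: bead_def)
  then show "part la i = part ka i" for i
    using la(2) ka(2) part_gt_length[of la i] part_gt_length[of ka i]
    by (cases "i = 0"; cases "i \<le> N") auto
qed

lemma strip_chain_par_subset:
  "strip_chain r la mu gs \<Longrightarrow> par_subset mu la"
proof (induction gs arbitrary: la rule: rev_induct)
  case Nil
  then show ?case by (simp add: strip_chain_def)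
next
  case (snoc x gs)
  have x: "x = la" using snoc.prems by (simp add: strip_chain_def)
  show ?case
  proof (cases "gs = []")
    case True
    then show ?thesis using snoc.prems by (auto simp: strip_chain_def par_subset_def)
  next
    case False
    then have "strip_chain r (last gs) mu gs" "border_strip r la (last gs)"
      using snoc.prems unfolding x strip_chain_snoc[OF False] by auto
    then have "par_subset mu (last gs)" "par_subset (last gs) la"
      using snoc.IH by (auto simp: border_strip_def is_skew_def)
    then show ?thesis unfolding par_subset_def by (rule subset_trans)
  qed
qed

lemma finite_Par: "finite (Par n)"
proof (rule finite_subset)
  have "set la \<subseteq> {0..n} \<and> length la \<le> n" if "is_partition la" "sum_list la = n" for la
  proof
    show "set la \<subseteq> {0..n}" using member_le_sum_list that(2) by fastforce
    have "length la = (\<Sum>i<length la. 1)" by simp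
    also have "\<dots> \<le> (\<Sum>i<length la. la ! i)"
      using that(1) by (intro sum_mono) (auto simp: is_partition_def Suc_le_eq)
    also have "\<dots> = n" using that(2) by (simp add: sum_list_sum_nth atLeast0LessThan)
    finally show "length la \<le> n" .
  qed
  then show "Par n \<subseteq> {la. set la \<subseteq> {0..n} \<and> length la \<le> n}" by (auto simp: Par_def)
qed (rule finite_lists_length_le, simp)

text \<open>The chain picked by \<open>SOME\<close> in \<open>sgn_r\<close> need not be known to be unique: the beads of any chain
  form a noncrossing configuration with the right alternant.\<close>

lemma decomposable_beads:
  assumes mu: "is_partition mu" "length mu \<le> N" and r: "0 < r"
    and la: "la \<in> Par (sum_list mu + r * m)" "length la \<le> N" and dec: "decomposable r la mu"
  shows "\<exists>g. g \<in> bead_moves r N (bead N mu) m \<and> noncrossing r N (bead N mu) g \<and>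
    g ` {1..N} = bead N la ` {1..N} \<and>
    alternant N g = of_int (sgn_r r la mu) * alternant N (bead N la)"
proof -
  define gs where "gs = (SOME gs. strip_chain r la mu gs)"
  have chain: "strip_chain r la mu gs"
    using dec unfolding gs_def decomposable_def by (rule someI_ex)
  then have "gs \<noteq> []" by (simp add: strip_chain_def)
  then obtain d where d: "length gs = Suc d" by (cases gs) auto
  obtain g p where c: "chain_beads r N mu d la gs g p"
    using chain_noncrossing[OF mu(1) r chain d la(2)] by blast
  have g: "g \<in> bead_moves r N (bead N mu) d" "noncrossing r N (bead N mu) g"
    and p: "p permutes {1..N}" and gp: "\<And>i. i \<in> {1..N} \<Longrightarrow> g i = bead N la (p i)"
    and sgn: "sign p = (\<Prod>i = 1..d. strip_sgn (gs ! i) (gs ! (i - 1)))"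
    using c unfolding chain_beads_def by blast+
  have "sgn_r r la mu = sign p"
    unfolding sgn using dec d by (simp add: sgn_r_def gs_def[symmetric])
  moreover have "alternant N g = of_int (sign p) * alternant N (bead N la)"
    using alternant_cong[of N g "\<lambda>i. bead N la (p i)"] gp alternant_permute[OF p, of "bead N la"] by simp
  moreover have "g ` {1..N} = bead N la ` {1..N}"
  proof -
    have "g ` {1..N} = bead N la ` p ` {1..N}" using gp by (auto simp: image_image intro!: image_cong)
    then show ?thesis using permutes_image[OF p] by simp
  qed
  \<comment> \<open>Each strip adds \<open>r\<close> to the total position, so the size of
    \<open>la\<close> fixes the number of strips.\<close>
  moreover have "d = m"
  proof -
    have "sum g {1..N} = (\<Sum>i\<in>{1..N}. bead N la (p i))" by (rule sum.cong) (use gp in auto)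
    also have "\<dots> = sum (bead N la) {1..N}"
      using sum.permute[OF p, of "bead N la"] by (simp add: comp_def)
    finally have "sum (bead N mu) {1..N} + r * d = sum (bead N la) {1..N}"
      using g(1) unfolding bead_moves_def by auto
    then show ?thesis
      using la(1) r unfolding sum_bead[OF la(2)] sum_bead[OF mu(2)] by (simp add: Par_def)
  qed
  ultimately show ?thesis using g by auto
qed

text \<open>Provides the surjectivity in \<open>sum_noncrossing\<close>; the size of
  \<open>la\<close> is read off from the total position of the beads.\<close>

lemma noncrossing_decomposable:
  assumes mu: "is_partition mu" "length mu \<le> N" and r: "0 < r"
    and g: "g \<in> bead_moves r N (bead N mu) m" "noncrossing r N (bead N mu) g"
  shows "\<exists>la \<in> Par (sum_list mu + r * m). par_subset mu la \<and> length la \<le> N \<and> decomposable r la mu \<and>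
    g ` {1..N} = bead N la ` {1..N}"
proof -
  obtain la gs p where c: "chain_beads r N mu m la gs g p"
    using noncrossing_chain[OF mu r g] by blast
  have chain: "strip_chain r la mu gs" and len: "length la \<le> N"
    and p: "p permutes {1..N}" and gp: "\<And>i. i \<in> {1..N} \<Longrightarrow> g i = bead N la (p i)"
    using c unfolding chain_beads_def by blast+
  have im: "g ` {1..N} = bead N la ` {1..N}"
  proof -
    have "g ` {1..N} = bead N la ` p ` {1..N}" using gp by (auto simp: image_image intro!: image_cong)
    then show ?thesis using permutes_image[OF p] by simp
  qed
  have "sum g {1..N} = (\<Sum>i\<in>{1..N}. bead N la (p i))" by (rule sum.cong) (use gp in auto)
  also have "\<dots> = sum (bead N la) {1..N}"
    using sum.permute[OF p, of "bead N la"] by (simp add: comp_def)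
  finally have "sum (bead N mu) {1..N} + r * m = sum (bead N la) {1..N}"
    using g(1) unfolding bead_moves_def by auto
  then have "la \<in> Par (sum_list mu + r * m)"
    using strip_chain_partition[OF chain]
    unfolding sum_bead[OF len] sum_bead[OF mu(2)] by (simp add: Par_def)
  then show ?thesis
    using strip_chain_par_subset[OF chain] len chain im unfolding decomposable_def by blast
qed

text \<open>Partitions and configurations correspond through their common set of positions: the set
  determines the partition, which gives injectivity, and the noncrossing configuration, which gives
  surjectivity.\<close>

lemma sum_noncrossing:
  assumes mu: "is_partition mu" "length mu \<le> N" and r: "0 < r"
  shows "(\<Sum>g | g \<in> bead_moves r N (bead N mu) m \<and> noncrossing r N (bead N mu) g. alternant N g) =
    (\<Sum>la | la \<in> Par (sum_list mu + r * m) \<and> par_subset mu la \<and> length la \<le> N \<and> decomposable r la mu.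
      of_int (sgn_r r la mu) * alternant N (bead N la))"
proof -
  let ?G = "{g. g \<in> bead_moves r N (bead N mu) m \<and> noncrossing r N (bead N mu) g}"
  let ?L = "{la. la \<in> Par (sum_list mu + r * m) \<and> par_subset mu la \<and> length la \<le> N \<and> decomposable r la mu}"
  have "\<forall>la\<in>?L. \<exists>g. g \<in> ?G \<and> g ` {1..N} = bead N la ` {1..N} \<and>
    alternant N g = of_int (sgn_r r la mu) * alternant N (bead N la)"
    using decomposable_beads[OF mu r] by blast
  from bchoice[OF this] obtain f where f_all: "\<forall>la\<in>?L. f la \<in> ?G \<and>
    f la ` {1..N} = bead N la ` {1..N} \<and>
    alternant N (f la) = of_int (sgn_r r la mu) * alternant N (bead N la)" ..
  have f: "f la \<in> ?G" "f la ` {1..N} = bead N la ` {1..N}"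
    "alternant N (f la) = of_int (sgn_r r la mu) * alternant N (bead N la)" if "la \<in> ?L" for la
    using bspec[OF f_all that] by simp_all
  have "bij_betw f ?L ?G"
  proof (rule bij_betw_imageI)
    show "inj_on f ?L"
    proof (rule inj_onI)
      fix la ka assume h: "la \<in> ?L" "ka \<in> ?L" "f la = f ka"
      then have "bead N la ` {1..N} = bead N ka ` {1..N}" using f(2)[OF h(1)] f(2)[OF h(2)] by simp
      then show "la = ka" using bead_image_eqD h unfolding Par_def by blast
    qed
    show "f ` ?L = ?G"
    proof (intro equalityI subsetI)
      fix g assume "g \<in> f ` ?L"
      then show "g \<in> ?G" using f(1) by blast
    next
      fix g assume g: "g \<in> ?G"
      then obtain la where la: "la \<in> ?L" "g ` {1..N} = bead N la ` {1..N}"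
        using noncrossing_decomposable[OF mu r, of g m] by blast
      have "f la = g"
        using noncrossing_eqI[OF mu(1), of "f la" r N m g] f(1,2)[OF la(1)] g la(2) by auto
      then show "g \<in> f ` ?L" using la(1) by blast
    qed
  qed
  from sum.reindex_bij_betw[OF this, of "alternant N", symmetric]
  have "(\<Sum>g\<in>?G. alternant N g) = (\<Sum>la\<in>?L. alternant N (f la))" .
  also have "\<dots> = (\<Sum>la\<in>?L. of_int (sgn_r r la mu) * alternant N (bead N la))"
    by (rule sum.cong[OF refl f(3)])
  finally show ?thesis .
qed

text \<open>Symmetric functions are families indexed by \<open>N\<close>; this and the next lemma
  reduce the identity to one in each number of variables.\<close>

lemma sum_fun_apply: "(\<Sum>x\<in>A. f x) y = (\<Sum>x\<in>A. f x y)"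
  by (induction A rule: infinite_finite_induct) auto

lemma of_int_fun_apply: "of_int k x = of_int k"
  by (cases k rule: int_diff_cases) simp

theorem theorem1p1:
  fixes mu :: "nat list" and r m :: nat
  assumes "is_partition mu" and "0 < r" and "0 < m"
  shows "schur mu * power_plethysm r (complete_hom m) =
           (\<Sum>la\<in>{la \<in> Par (sum_list mu + r * m). par_subset mu la}.
              of_int (sgn_r r la mu) * schur la)"
proof
  fix N
  let ?L = "{la \<in> Par (sum_list mu + r * m). par_subset mu la}"
  let ?P = "power_plethysm r (complete_hom m) N" and ?d = "alternant N (staircase N)"
  have "schur mu N * ?P = (\<Sum>la\<in>?L. of_int (sgn_r r la mu) * schur la N)"
  proof (cases "length mu \<le> N")
    \<comment> \<open>With fewer variables than parts of \<open>mu\<close>, every \<open>la\<close>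
      containing \<open>mu\<close> also has more than \<open>N\<close> parts, so all Schur functions
      involved specialise to 0.\<close>
    case False
    have "schur la N = 0" if "la \<in> ?L" for la
      using that length_mono[OF assms(1), of la] False by (auto simp: schur_def Par_def)
    moreover have "schur mu N = 0" using False by (simp add: schur_def)
    ultimately show ?thesis by simp
  next
    case True
    let ?D = "{la. la \<in> Par (sum_list mu + r * m) \<and> par_subset mu la \<and> length la \<le> N \<and> decomposable r la mu}"
    have schur: "schur la N * ?d = alternant N (bead N la)" if "length la \<le> N" for la
      using schur_times_vandermonde[OF that] by (simp add: bead_def[abs_def])
    have "(schur mu N * ?P) * ?d = alternant N (bead N mu) * ?P"
      using schur[OF True] by (simp add: mult.commute mult.left_commute)
    also have "\<dots> = (\<Sum>la\<in>?D. of_int (sgn_r r la mu) * alternant N (bead N la))"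
      using alternant_times_plethysm_noncrossing[OF assms(2) bead_strict_antimono[OF assms(1)]]
        sum_noncrossing[OF assms(1) True assms(2)] by simp
    also have "\<dots> = (\<Sum>la\<in>?D. of_int (sgn_r r la mu) * schur la N * ?d)"
      by (rule sum.cong) (auto simp: schur mult.assoc)
    \<comment> \<open>The extra partitions contribute 0: if not decomposable, \<open>sgn_r\<close>
      vanishes; if longer than \<open>N\<close>, \<open>schur\<close> does.\<close>
    also have "\<dots> = (\<Sum>la\<in>?L. of_int (sgn_r r la mu) * schur la N * ?d)"
      by (rule sum.mono_neutral_left) (auto simp: finite_Par sgn_r_def schur_def)
    finally have "(schur mu N * ?P) * ?d = (\<Sum>la\<in>?L. of_int (sgn_r r la mu) * schur la N) * ?d"
      by (simp add: sum_distrib_right)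
    \<comment> \<open>The staircase has distinct entries, so the Vandermonde determinant is nonzero
      and cancels.\<close>
    from mult_right_cancel[OF alternant_nonzero[OF staircase_inj], THEN iffD1, OF this]
    show ?thesis .
  qed
  then show "(schur mu * power_plethysm r (complete_hom m)) N =
      (\<Sum>la\<in>?L. of_int (sgn_r r la mu) * schur la) N"
    by (simp add: sum_fun_apply of_int_fun_apply)
qed

end
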